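(* If an arithmetic matroid with a basis of multiplicity $1$ is representable by a matrix $A$, then $A$ is unique up to sign reversal of the column vectors (and up to change of basis of the lattice $\mathbb Z^d$). That is: let $A$ and $A'$ be two $d\times n$ integer matrices, both representing the same arithmetic matroid of rank $d$ on the ground set $[n]$, and suppose that this arithmetic matroid has a basis of multiplicity $1$. Then there exist $U\in GL_d(\mathbb Z)$ and a diagonal $n\times n$ matrix $D$ with diagonal entries in $\{\pm1\}$ such that $A'=UAD$.
   Context: For an integer $d\times n$ matrix $A$ of rank $d$ and $I\subseteq[n]$ let $A(I)$ be the submatrix of columns indexed by $I$, and let $m(I)$ be the product of the (nonzero) invariant factors of $A(I)$ (Smith normal form), with $m(\emptyset)=1$; in particular if $|I|=d$ and $A(I)$ is nonsingular then $m(I)=|\det A(I)|$. The arithmetic matroid represented by $A$ is the pair consisting of the $\mathbb Q$-linear dependency matroid of the columns of $A$ (on ground set $[n]$) and the multiplicity function $m:2^{[n]}\to\mathbb Z_{>0}$. Two matrices represent the same arithmetic matroid iff they have the same dependency matroid and the same function $m$. A basis of multiplicity $1$ is a matroid basis $I$ with $m(I)=1$ (a unimodular basis). *)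

theory Defs
  imports
    Main
    "Jordan_Normal_Form.DL_Rank"
    "Jordan_Normal_Form.DL_Rank_Submatrix"
    "HOL-Library.FuncSet"
begin

text \<open>Columns are indexed from \<open>0\<close>, so the ground set \<open>[n]\<close> is \<open>{..<n}\<close>.
  Matrices with no rows or no columns are allowed.\<close>

definition column_submatrix :: "'a mat \<Rightarrow> nat set \<Rightarrow> 'a mat" where
  "column_submatrix A I = submatrix A UNIV I"

definition smith_normal_form_of :: "int mat \<Rightarrow> int mat \<Rightarrow> bool" where
  "smith_normal_form_of B S \<longleftrightarrow>
     S \<in> carrier_mat (dim_row B) (dim_col B) \<and>
     diagonal_mat S \<and>
     (\<forall>i < min (dim_row S) (dim_col S). 0 \<le> S $$ (i, i)) \<and>
     (\<forall>i. i + 1 < min (dim_row S) (dim_col S) \<longrightarrow> S $$ (i, i) dvd S $$ (i + 1, i + 1)) \<and>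
     (\<exists>P \<in> carrier_mat (dim_row B) (dim_row B). \<exists>Q \<in> carrier_mat (dim_col B) (dim_col B).
        invertible_mat P \<and> invertible_mat Q \<and> S = P * B * Q)"

text \<open>Every integer matrix has exactly one Smith normal form (the diagonal being
  non-negative), so the choice below is immaterial.\<close>

definition smith_normal_form :: "int mat \<Rightarrow> int mat" where
  "smith_normal_form B = (SOME S. smith_normal_form_of B S)"

text \<open>The product of the nonzero invariant factors; it is \<open>1\<close> when there are none.\<close>

definition invariant_factor_product :: "int mat \<Rightarrow> nat" where
  "invariant_factor_product B =
     (let S = smith_normal_form B in
      nat (\<Prod>i \<in> {i. i < min (dim_row S) (dim_col S) \<and> S $$ (i, i) \<noteq> 0}. S $$ (i, i)))"

text \<open>A matroid, given by its ground set and its independent sets, together with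
  a multiplicity function.\<close>

record arith_matroid =
  ground :: "nat set"
  indep :: "nat set set"
  mult_fun :: "nat set \<Rightarrow> nat"

definition is_basis :: "arith_matroid \<Rightarrow> nat set \<Rightarrow> bool" where
  "is_basis M B \<longleftrightarrow> B \<in> indep M \<and> (\<forall>J \<in> indep M. B \<subseteq> J \<longrightarrow> J = B)"

text \<open>Independence over the rationals of the family of columns indexed by \<open>I\<close>.
  The library notion concerns sets of vectors; injectivity accounts for
  repeated columns, which are dependent.\<close>

definition columns_indep :: "int mat \<Rightarrow> nat set \<Rightarrow> bool" where
  "columns_indep A I \<longleftrightarrow>
     inj_on (col (map_mat rat_of_int A)) I \<and>
     \<not> module.lin_dep class_ring (module_vec TYPE(rat) (dim_row A))
         (col (map_mat rat_of_int A) ` I)"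

text \<open>The multiplicity function is restricted to subsets of the ground set, so that
  \<open>arith_matroid_of A = arith_matroid_of A'\<close> means equality of the dependency
  matroids and of the multiplicities of all subsets of the ground set.\<close>

definition arith_matroid_of :: "int mat \<Rightarrow> arith_matroid" where
  "arith_matroid_of A =
     \<lparr> ground = {..<dim_col A},
       indep = {I. I \<subseteq> {..<dim_col A} \<and> columns_indep A I},
       mult_fun = (\<lambda>I \<in> Pow {..<dim_col A}. invariant_factor_product (column_submatrix A I)) \<rparr>"

definition represents :: "nat \<Rightarrow> nat \<Rightarrow> int mat \<Rightarrow> arith_matroid \<Rightarrow> bool" where
  "represents d n A M \<longleftrightarrow>
     A \<in> carrier_mat d n \<and>
     vec_space.rank d (map_mat rat_of_int A) = d \<and>
     M = arith_matroid_of A"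

end

(* Multiplying A and A' by the inverses of their submatrices at the unimodular basis gives integer
   matrices C and C' containing the unit vectors in the same columns; the arithmetic matroid says
   that all maximal minors of C and C' agree up to sign. Add the columns one by one, keeping C' equal
   to C up to row and column signs. If a new column k forces opposite signs on two rows, say that two
   rows are adjacent when some earlier column is nonzero in both. Were rows of opposite sign in one
   component, a shortest path between two such rows would be chordless, with column k zero inside.
   Eliminating along it gives a functional, proportional to a maximal minor, that sees column k only
   at the two ends: its values x + y for C and x - y for C', with x and y nonzero, would have equal
   absolute values. So the signs of a component can be flipped together. *)
theory Submission
  imports Defs
begin

section \<open>Matrices with equal maximal minors up to sign\<close>

lemma index_mult_mat_sum:
  assumes "A \<in> carrier_mat n m" "B \<in> carrier_mat m k" "i < n" "j < k"
  shows "(A * B) $$ (i, j) = (\<Sum>l<m. A $$ (i, l) * B $$ (l, j))"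
  using assms by (auto simp: scalar_prod_def atLeast0LessThan intro!: sum.cong)

text \<open>Columns are chosen by a function rather than a set, so that they keep prescribed
  positions, may repeat, and can be exchanged one at a time by function update.\<close>

definition select_columns :: "'a mat \<Rightarrow> (nat \<Rightarrow> nat) \<Rightarrow> 'a mat" where
  "select_columns A f = mat (dim_row A) (dim_row A) (\<lambda>(i, j). A $$ (i, f j))"

lemma select_columns_carrier [simp]:
  "A \<in> carrier_mat d n \<Longrightarrow> select_columns A f \<in> carrier_mat d d"
  by (auto simp: select_columns_def)

lemma select_columns_index [simp]:
  "A \<in> carrier_mat d n \<Longrightarrow> i < d \<Longrightarrow> j < d \<Longrightarrow> select_columns A f $$ (i, j) = A $$ (i, f j)"
  by (auto simp: select_columns_def)

text \<open>A functional vanishing on all columns but one is proportional to the determinant as a function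
  of that column.\<close>

lemma det_replace_column_functional:
  fixes N N0 :: "'a :: comm_ring_1 mat" and \<phi> :: "nat \<Rightarrow> 'a"
  assumes N: "N \<in> carrier_mat d d" and N0: "N0 \<in> carrier_mat d d" and p: "p < d"
    and eq: "\<And>i j. i < d \<Longrightarrow> j < d \<Longrightarrow> j \<noteq> p \<Longrightarrow> N $$ (i, j) = N0 $$ (i, j)"
    and unit: "\<And>i. i < d \<Longrightarrow> N0 $$ (i, p) = (if i = p then 1 else 0)"
    and \<phi>: "\<And>j. j < d \<Longrightarrow> j \<noteq> p \<Longrightarrow> (\<Sum>i<d. \<phi> i * N $$ (i, j)) = 0"
  shows "\<phi> p * det N = det N0 * (\<Sum>i<d. \<phi> i * N $$ (i, p))"
proof -
  let ?G = "adj_mat N0"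
  note adj = adj_mat[OF N0]
  have \<phi>0: "(\<Sum>k<d. \<phi> k * N0 $$ (k, l)) = (if l = p then \<phi> p else 0)" if "l < d" for l
  proof (cases "l = p")
    case True
    have "(\<Sum>k<d. \<phi> k * N0 $$ (k, l)) = (\<Sum>k<d. if k = p then \<phi> k else 0)"
      by (rule sum.cong) (auto simp: True unit)
    then show ?thesis using p True by simp
  next
    case False
    have "(\<Sum>k<d. \<phi> k * N0 $$ (k, l)) = (\<Sum>k<d. \<phi> k * N $$ (k, l))"
      by (rule sum.cong) (auto simp: eq that False)
    then show ?thesis using \<phi>[OF that False] False by simp
  qed
  \<comment> \<open>By \<open>\<phi>0\<close>, the row vector \<open>\<phi>\<close> times
    \<open>N0\<close> is \<open>\<phi> p\<close> times the \<open>p\<close>-th unit row. Multiplying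
    by the adjugate recovers \<open>\<phi>\<close> up to the factor \<open>det N0\<close> without
    any division.\<close>
  have row: "det N0 * \<phi> i = \<phi> p * ?G $$ (p, i)" if i: "i < d" for i
  proof -
    have e: "(\<Sum>l<d. N0 $$ (k, l) * ?G $$ (l, i)) = (if k = i then det N0 else 0)" if "k < d" for k
    proof -
      have "(N0 * ?G) $$ (k, i) = (\<Sum>l<d. N0 $$ (k, l) * ?G $$ (l, i))"
        by (rule index_mult_mat_sum[OF N0 adj(1) that i])
      then show ?thesis using adj(2) that i by auto
    qed
    have "det N0 * \<phi> i = (\<Sum>k<d. if k = i then \<phi> k * det N0 else 0)"
      using i by (simp add: mult.commute)
    also have "\<dots> = (\<Sum>k<d. \<phi> k * (\<Sum>l<d. N0 $$ (k, l) * ?G $$ (l, i)))"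
      by (rule sum.cong) (auto simp: e)
    also have "\<dots> = (\<Sum>l<d. (\<Sum>k<d. \<phi> k * N0 $$ (k, l)) * ?G $$ (l, i))"
      unfolding sum_distrib_left sum_distrib_right by (subst sum.swap) (simp add: mult.assoc)
    also have "\<dots> = (\<Sum>l<d. if l = p then \<phi> p * ?G $$ (l, i) else 0)"
      by (rule sum.cong) (auto simp: \<phi>0)
    finally show ?thesis using p by simp
  qed
  \<comment> \<open>These cofactors delete column \<open>p\<close>, the only place where
    \<open>N\<close> and \<open>N0\<close> differ, so Laplace expansion of \<open>N\<close> along
    that column can finish the computation.\<close>
  have cof: "?G $$ (p, i) = cofactor N i p" if "i < d" for i
  proof -
    have "mat_delete N0 i p = mat_delete N i p"
      using N N0 eq p that by (intro eq_matI) (auto simp: mat_delete_def)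
    then show ?thesis using N0 p that by (auto simp: adj_mat_def cofactor_def)
  qed
  have "det N0 * (\<Sum>i<d. \<phi> i * N $$ (i, p)) = (\<Sum>i<d. (det N0 * \<phi> i) * N $$ (i, p))"
    by (simp add: sum_distrib_left mult.assoc)
  also have "\<dots> = (\<Sum>i<d. (\<phi> p * cofactor N i p) * N $$ (i, p))"
    by (rule sum.cong) (simp_all add: row cof)
  also have "\<dots> = \<phi> p * (\<Sum>i<d. N $$ (i, p) * cofactor N i p)"
    by (simp add: sum_distrib_left ac_simps)
  also have "\<dots> = \<phi> p * det N" using laplace_expansion_column[OF N p] by simp
  finally show ?thesis by simp
qed

text \<open>For both matrices, the value of the functional on the free column times one minor equals
  its coefficient at \<open>p\<close> times another minor. Minors and coefficients agree in absolute
  value, and the nonzero minor cancels.\<close>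

lemma abs_functional_eq:
  fixes C C' :: "int mat" and \<phi> \<psi> :: "nat \<Rightarrow> int"
  assumes C: "C \<in> carrier_mat d n" "C' \<in> carrier_mat d n"
    and b: "\<And>j. j < d \<Longrightarrow> b j < n"
      "\<And>i j. i < d \<Longrightarrow> j < d \<Longrightarrow> C $$ (i, b j) = (if i = j then 1 else 0)"
      "\<And>i j. i < d \<Longrightarrow> j < d \<Longrightarrow> C' $$ (i, b j) = (if i = j then 1 else 0)"
    and minors: "\<And>f. (\<And>j. j < d \<Longrightarrow> f j < n) \<Longrightarrow>
      \<bar>det (select_columns C f)\<bar> = \<bar>det (select_columns C' f)\<bar>"
    and p: "p < d" and f: "\<And>j. j < d \<Longrightarrow> f j < n"
    and \<phi>: "\<And>j. j < d \<Longrightarrow> j \<noteq> p \<Longrightarrow> (\<Sum>i<d. \<phi> i * C $$ (i, f j)) = 0"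
    and \<psi>: "\<And>j. j < d \<Longrightarrow> j \<noteq> p \<Longrightarrow> (\<Sum>i<d. \<psi> i * C' $$ (i, f j)) = 0"
    and p_eq: "\<bar>\<phi> p\<bar> = \<bar>\<psi> p\<bar>"
    and nz: "det (select_columns C (f(p := b p))) \<noteq> 0"
  shows "\<bar>\<Sum>i<d. \<phi> i * C $$ (i, f p)\<bar> = \<bar>\<Sum>i<d. \<psi> i * C' $$ (i, f p)\<bar>"
proof -
  let ?f = "f(p := b p)"
  have 1: "\<phi> p * det (select_columns C f) = det (select_columns C ?f) * (\<Sum>i<d. \<phi> i * C $$ (i, f p))"
    using det_replace_column_functional[of "select_columns C f" d "select_columns C ?f" p \<phi>]
      C p b \<phi> by simp
  have 2: "\<psi> p * det (select_columns C' f) = det (select_columns C' ?f) * (\<Sum>i<d. \<psi> i * C' $$ (i, f p))"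
    using det_replace_column_functional[of "select_columns C' f" d "select_columns C' ?f" p \<psi>]
      C p b \<psi> by simp
  have 3: "\<bar>det (select_columns C f)\<bar> = \<bar>det (select_columns C' f)\<bar>" using f by (rule minors)
  have 4: "\<bar>det (select_columns C ?f)\<bar> = \<bar>det (select_columns C' ?f)\<bar>"
    by (rule minors) (use f b p in auto)
  have "\<bar>det (select_columns C ?f)\<bar> * \<bar>\<Sum>i<d. \<phi> i * C $$ (i, f p)\<bar> =
        \<bar>det (select_columns C ?f)\<bar> * \<bar>\<Sum>i<d. \<psi> i * C' $$ (i, f p)\<bar>"
    using arg_cong[OF 1, of abs] arg_cong[OF 2, of abs] 3 4 p_eq by (simp add: abs_mult)
  then show ?thesis using nz by simp
qed

section \<open>Excluding sign changes between connected rows\<close>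

text \<open>A functional supported on the path kills every selected column except column
  \<open>k\<close>, and its twist by \<open>s\<close> does the same for \<open>C'\<close>. On column
  \<open>k\<close> only the two end rows contribute, with equal signs for \<open>C\<close> and
  opposite signs for \<open>C'\<close>.\<close>

lemma no_sign_switching_path:
  fixes C C' :: "int mat" and s t :: "nat \<Rightarrow> int"
  assumes C: "C \<in> carrier_mat d n" "C' \<in> carrier_mat d n"
    and b: "\<And>j. j < d \<Longrightarrow> b j < n"
      "\<And>i j. i < d \<Longrightarrow> j < d \<Longrightarrow> C $$ (i, b j) = (if i = j then 1 else 0)"
      "\<And>i j. i < d \<Longrightarrow> j < d \<Longrightarrow> C' $$ (i, b j) = (if i = j then 1 else 0)"
    and minors: "\<And>f. (\<And>j. j < d \<Longrightarrow> f j < n) \<Longrightarrow>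
      \<bar>det (select_columns C f)\<bar> = \<bar>det (select_columns C' f)\<bar>"
    and s: "\<And>i. \<bar>s i\<bar> = 1"
    and K: "K \<subseteq> {..<n}" "\<And>i j. i < d \<Longrightarrow> j \<in> K \<Longrightarrow> C' $$ (i, j) = s i * C $$ (i, j) * t j"
    and k: "k < n"
    and r: "\<And>m. m \<le> L \<Longrightarrow> r m < d" "inj_on r {..L}"
    and c: "\<And>m. m < L \<Longrightarrow> c m \<in> K"
      "\<And>m. m < L \<Longrightarrow> C $$ (r m, c m) \<noteq> 0" "\<And>m. m < L \<Longrightarrow> C $$ (r (Suc m), c m) \<noteq> 0"
      "\<And>i m. i \<le> L \<Longrightarrow> m < L \<Longrightarrow> C $$ (r i, c m) \<noteq> 0 \<Longrightarrow> i = m \<or> i = Suc m"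
    and inner: "\<And>m. 0 < m \<Longrightarrow> m < L \<Longrightarrow> C $$ (r m, k) = 0" "\<And>m. 0 < m \<Longrightarrow> m < L \<Longrightarrow> C' $$ (r m, k) = 0"
    and ends: "C $$ (r 0, k) \<noteq> 0" "s (r 0) * C' $$ (r 0, k) = C $$ (r 0, k)"
      "C $$ (r L, k) \<noteq> 0" "s (r L) * C' $$ (r L, k) = - C $$ (r L, k)"
  shows False
proof -
  \<comment> \<open>For \<open>L = 0\<close> the conditions in \<open>ends\<close> would make a
    nonzero entry its own negative.\<close>
  have L: "0 < L" using ends by (cases "L = 0") auto
  \<comment> \<open>A functional supported on the path and vanishing on the columns \<open>c m\<close> has consecutive values in
    ratio \<open>- C (r m, c m) : C (r (m+1), c m)\<close>; this is the solution with denominators cleared.\<close>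
  define \<rho> where "\<rho> m = (-1) ^ m * (\<Prod>l<m. C $$ (r l, c l)) * (\<Prod>l\<in>{m..<L}. C $$ (r (Suc l), c l))" for m
  have \<rho>nz: "\<rho> m \<noteq> 0" if "m \<le> L" for m
    using that c(2,3) by (auto simp: \<rho>_def)
  have \<rho>step: "\<rho> m * C $$ (r m, c m) + \<rho> (Suc m) * C $$ (r (Suc m), c m) = 0" if "m < L" for m
  proof -
    have "{m..<L} = insert m {Suc m..<L}" using that by auto
    then show ?thesis by (simp add: \<rho>_def)
  qed
  define \<phi> where "\<phi> i = (if i \<in> r ` {..L} then \<rho> (the_inv_into {..L} r i) else 0)" for i
  have \<phi>r: "\<phi> (r m) = \<rho> m" if "m \<le> L" for m
    using that by (auto simp: \<phi>_def the_inv_into_f_f[OF r(2)])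
  have supp: "(\<Sum>i<d. v i * X i) = (\<Sum>m\<le>L. v (r m) * X (r m))"
    if "\<And>i. i < d \<Longrightarrow> i \<notin> r ` {..L} \<Longrightarrow> v i = 0" for v X :: "nat \<Rightarrow> int"
  proof -
    have "(\<Sum>i<d. v i * X i) = (\<Sum>i\<in>r ` {..L}. v i * X i)"
      by (rule sum.mono_neutral_right) (use r that in auto)
    also have "\<dots> = (\<Sum>m\<le>L. v (r m) * X (r m))"
      using sum.reindex[OF r(2)] by simp
    finally show ?thesis .
  qed
  \<comment> \<open>By chordlessness, column \<open>c l\<close> meets the path only in the rows
    \<open>r l\<close> and \<open>r (Suc l)\<close>.\<close>
  have two: "(\<Sum>m\<le>L. X m * C $$ (r m, c l)) = X l * C $$ (r l, c l) + X (Suc l) * C $$ (r (Suc l), c l)"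
    if "l < L" for X :: "nat \<Rightarrow> int" and l
  proof -
    have "(\<Sum>m\<le>L. X m * C $$ (r m, c l)) = (\<Sum>m\<in>{l, Suc l}. X m * C $$ (r m, c l))"
      by (rule sum.mono_neutral_right) (use that c(4) in auto)
    then show ?thesis by simp
  qed
  \<comment> \<open>Position \<open>r 0\<close> receives column \<open>k\<close>, position
    \<open>r (Suc m)\<close> receives \<open>c m\<close> (hence the shift by one), and each position
    off the path keeps its own unit column.\<close>
  define f where "f i = (if i = r 0 then k else if i \<in> r ` {..L}
    then c (the_inv_into {..L} r i - 1) else b i)" for i
  have f0: "f (r 0) = k" by (simp add: f_def)
  have fS: "f (r (Suc m)) = c m" if "m < L" for m
    using that r(2) by (auto simp: f_def the_inv_into_f_f[OF r(2)] inj_on_def)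
  have fb: "f i = b i" if "i \<notin> r ` {..L}" for i
    using that by (auto simp: f_def)
  have cases: "(\<exists>m<L. i = r (Suc m)) \<or> i \<notin> r ` {..L}" if "i \<noteq> r 0" for i
    using that by (auto simp: image_iff) (metis Suc_le_lessD not0_implies_Suc)
  have fn: "f j < n" if "j < d" for j
  proof (cases "j = r 0")
    case False
    then show ?thesis using cases[OF False] fS fb b(1)[OF that] c(1) K(1) by fastforce
  qed (use f0 k in auto)
  have \<phi>C: "(\<Sum>i<d. \<phi> i * C $$ (i, f j)) = 0" if "j < d" "j \<noteq> r 0" for j
    using cases[OF that(2)]
  proof
    assume "\<exists>m<L. j = r (Suc m)"
    then obtain m where m: "m < L" "j = r (Suc m)" by auto
    have "(\<Sum>i<d. \<phi> i * C $$ (i, c m)) = (\<Sum>l\<le>L. \<phi> (r l) * C $$ (r l, c m))"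
      by (rule supp) (auto simp: \<phi>_def)
    also have "\<dots> = 0" using two[OF m(1), of "\<lambda>l. \<phi> (r l)"] \<phi>r \<rho>step[OF m(1)] m by simp
    finally show ?thesis using m fS by simp
  next
    assume j: "j \<notin> r ` {..L}"
    then have "\<phi> j = 0" by (simp add: \<phi>_def)
    then show ?thesis using that b(2) by (auto simp: fb[OF j] intro!: sum.neutral)
  qed
  \<comment> \<open>On columns in \<open>K\<close> the signs \<open>s i\<close> square to one and
    \<open>t (f j)\<close> factors out, which reduces the claim to \<open>\<phi>C\<close>.\<close>
  have \<psi>C: "(\<Sum>i<d. (s i * \<phi> i) * C' $$ (i, f j)) = 0" if "j < d" "j \<noteq> r 0" for j
    using cases[OF that(2)]
  proof
    assume "\<exists>m<L. j = r (Suc m)"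
    then obtain m where m: "m < L" "j = r (Suc m)" by auto
    then have fK: "f j \<in> K" using fS c(1) by simp
    have ss: "s i * s i = 1" for i using s[of i] by (metis abs_mult_self_eq mult_1)
    have "(\<Sum>i<d. (s i * \<phi> i) * C' $$ (i, f j)) = (\<Sum>i<d. (s i * s i) * (\<phi> i * C $$ (i, f j)) * t (f j))"
      by (rule sum.cong) (simp_all add: K(2)[OF _ fK])
    also have "\<dots> = (\<Sum>i<d. \<phi> i * C $$ (i, f j)) * t (f j)" by (simp add: ss sum_distrib_right)
    finally show ?thesis using \<phi>C[OF that] by simp
  next
    assume j: "j \<notin> r ` {..L}"
    then have "\<phi> j = 0" by (simp add: \<phi>_def)
    then show ?thesis using that b(3) by (auto simp: fb[OF j] intro!: sum.neutral)
  qed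
  let ?N = "select_columns C (f(r 0 := b (r 0)))"
  have dimN: "dim_row ?N = d" "dim_col ?N = d"
    using C(1) by (simp_all add: select_columns_def)
  \<comment> \<open>A vector \<open>v\<close> orthogonal to all columns of \<open>?N\<close>
    vanishes at \<open>r 0\<close> and off the path because of the unit columns there. It then
    vanishes along the path row by row, since \<open>c m\<close> is nonzero at
    \<open>r (Suc m)\<close> and otherwise meets the path only at \<open>r m\<close>.\<close>
  have nz: "det ?N \<noteq> 0"
  proof
    assume "det ?N = 0"
    then have "det (transpose_mat ?N) = 0" using C(1) by (subst det_transpose[of _ d]) auto
    then obtain v where v: "v \<in> carrier_vec d" "v \<noteq> 0\<^sub>v d" "transpose_mat ?N *\<^sub>v v = 0\<^sub>v d"
      using det_0_iff_vec_prod_zero[of "transpose_mat ?N" d] C(1) by auto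
    have vN: "(\<Sum>i<d. v $ i * C $$ (i, (f(r 0 := b (r 0))) j)) = 0" if "j < d" for j
    proof -
      have "(transpose_mat ?N *\<^sub>v v) $ j = (\<Sum>i<d. v $ i * C $$ (i, (f(r 0 := b (r 0))) j))"
        using that v(1) C(1) dimN
        by (auto simp del: fun_upd_apply simp: scalar_prod_def atLeast0LessThan mult.commute
            intro!: sum.cong)
      then show ?thesis using v(3) that by simp
    qed
    have unit: "(\<Sum>i<d. v $ i * C $$ (i, b j)) = v $ j" if "j < d" for j
    proof -
      have "(\<Sum>i<d. v $ i * C $$ (i, b j)) = (\<Sum>i<d. if i = j then v $ i else 0)"
        by (rule sum.cong) (use b(2) that in auto)
      then show ?thesis using that by simp
    qed
    have r0: "r 0 < d" using r(1) by simp
    have v0: "v $ r 0 = 0" using vN[OF r0] unit[OF r0] by simp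
    have vout: "v $ j = 0" if "j < d" "j \<notin> r ` {..L}" for j
    proof -
      have "j \<noteq> r 0" using that by auto
      then show ?thesis using vN[OF that(1)] unit[OF that(1)] fb[OF that(2)] by simp
    qed
    have vr: "m \<le> L \<Longrightarrow> v $ (r m) = 0" for m
    proof (induction m)
      case (Suc m)
      then have m: "m < L" by simp
      have "r (Suc m) \<noteq> r 0" using r(2) m by (auto simp: inj_on_def)
      then have "0 = (\<Sum>i<d. v $ i * C $$ (i, c m))"
        using vN[of "r (Suc m)"] r(1)[OF Suc.prems] fS[OF m] by simp
      also have "\<dots> = (\<Sum>l\<le>L. v $ (r l) * C $$ (r l, c m))"
        by (rule supp) (use vout in auto)
      also have "\<dots> = v $ (r (Suc m)) * C $$ (r (Suc m), c m)"
        using two[OF m, of "\<lambda>l. v $ (r l)"] Suc.IH m by simp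
      finally show ?case using c(3)[OF m] by simp
    qed (use v0 in simp)
    have "v = 0\<^sub>v d" using v(1) vr vout by (intro eq_vecI) (auto simp: image_iff)
    then show False using v(2) by simp
  qed
  have "\<bar>\<Sum>i<d. \<phi> i * C $$ (i, f (r 0))\<bar> = \<bar>\<Sum>i<d. (s i * \<phi> i) * C' $$ (i, f (r 0))\<bar>"
    by (rule abs_functional_eq[OF C b minors, where p = "r 0" and f = f])
      (use fn \<phi>C \<psi>C nz r(1) s in \<open>auto simp: abs_mult\<close>)
  moreover have "(\<Sum>i<d. \<phi> i * C $$ (i, k)) = \<rho> 0 * C $$ (r 0, k) + \<rho> L * C $$ (r L, k)"
  proof -
    have "(\<Sum>i<d. \<phi> i * C $$ (i, k)) = (\<Sum>l\<le>L. \<phi> (r l) * C $$ (r l, k))"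
      by (rule supp) (auto simp: \<phi>_def)
    also have "\<dots> = (\<Sum>l\<in>{0, L}. \<phi> (r l) * C $$ (r l, k))"
      by (rule sum.mono_neutral_right) (use inner in auto)
    finally show ?thesis using L \<phi>r by simp
  qed
  moreover have "(\<Sum>i<d. (s i * \<phi> i) * C' $$ (i, k)) = \<rho> 0 * C $$ (r 0, k) - \<rho> L * C $$ (r L, k)"
  proof -
    have "(\<Sum>i<d. (s i * \<phi> i) * C' $$ (i, k)) = (\<Sum>l\<le>L. (s (r l) * \<phi> (r l)) * C' $$ (r l, k))"
      by (rule supp) (auto simp: \<phi>_def)
    also have "\<dots> = (\<Sum>l\<in>{0, L}. (s (r l) * \<phi> (r l)) * C' $$ (r l, k))"
      by (rule sum.mono_neutral_right) (use inner in auto)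
    also have "\<dots> = \<phi> (r 0) * (s (r 0) * C' $$ (r 0, k)) + \<phi> (r L) * (s (r L) * C' $$ (r L, k))"
      using L by (simp add: ac_simps)
    finally show ?thesis using \<phi>r ends by simp
  qed
  ultimately have "\<bar>\<rho> 0 * C $$ (r 0, k) + \<rho> L * C $$ (r L, k)\<bar> = \<bar>\<rho> 0 * C $$ (r 0, k) - \<rho> L * C $$ (r L, k)\<bar>"
    using f0 by simp
  \<comment> \<open>The sum and the difference of two nonzero integers never have the same absolute
    value.\<close>
  then have "\<rho> 0 * C $$ (r 0, k) = 0 \<or> \<rho> L * C $$ (r L, k) = 0" by linarith
  then show False using \<rho>nz[of 0] \<rho>nz[of L] ends by simp
qed

text \<open>The coordinate functional at row \<open>i\<close> kills all other unit columns, so the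
  entry is the minor obtained by putting column \<open>k\<close> in place of the \<open>i\<close>-th
  unit column.\<close>

lemma abs_entry_eq:
  fixes C C' :: "int mat"
  assumes C: "C \<in> carrier_mat d n" "C' \<in> carrier_mat d n"
    and b: "\<And>j. j < d \<Longrightarrow> b j < n"
      "\<And>i j. i < d \<Longrightarrow> j < d \<Longrightarrow> C $$ (i, b j) = (if i = j then 1 else 0)"
      "\<And>i j. i < d \<Longrightarrow> j < d \<Longrightarrow> C' $$ (i, b j) = (if i = j then 1 else 0)"
    and minors: "\<And>f. (\<And>j. j < d \<Longrightarrow> f j < n) \<Longrightarrow>
      \<bar>det (select_columns C f)\<bar> = \<bar>det (select_columns C' f)\<bar>"
    and i: "i < d" and k: "k < n"
  shows "\<bar>C $$ (i, k)\<bar> = \<bar>C' $$ (i, k)\<bar>"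
proof -
  define \<phi> :: "nat \<Rightarrow> int" where "\<phi> l = (if l = i then 1 else 0)" for l
  have \<phi>: "(\<Sum>l<d. \<phi> l * X l) = X i" for X
  proof -
    have "(\<Sum>l<d. \<phi> l * X l) = (\<Sum>l<d. if l = i then X l else 0)"
      by (rule sum.cong) (auto simp: \<phi>_def)
    then show ?thesis using i by simp
  qed
  have "select_columns C b = 1\<^sub>m d"
    using C b(2) by (intro eq_matI) (auto simp: select_columns_def)
  moreover have "(b(i := k))(i := b i) = b" by simp
  ultimately have "det (select_columns C ((b(i := k))(i := b i))) \<noteq> 0" by simp
  then have "\<bar>\<Sum>l<d. \<phi> l * C $$ (l, (b(i := k)) i)\<bar> = \<bar>\<Sum>l<d. \<phi> l * C' $$ (l, (b(i := k)) i)\<bar>"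
    by (intro abs_functional_eq[OF C b minors i, where f = "b(i := k)"]) (use b i k in \<open>auto simp: \<phi>\<close>)
  then show ?thesis by (simp add: \<phi>)
qed

text \<open>Reduces connectedness in the row graph \<open>R\<close> to the chordless situation of
  \<open>no_sign_switching_path\<close>. A component of \<open>R\<close> is a block of rows tied
  together by columns whose signs are already matched.\<close>

lemma no_sign_switch_in_component:
  fixes C C' :: "int mat" and s t :: "nat \<Rightarrow> int"
  assumes C: "C \<in> carrier_mat d n" "C' \<in> carrier_mat d n"
    and b: "\<And>j. j < d \<Longrightarrow> b j < n"
      "\<And>i j. i < d \<Longrightarrow> j < d \<Longrightarrow> C $$ (i, b j) = (if i = j then 1 else 0)"
      "\<And>i j. i < d \<Longrightarrow> j < d \<Longrightarrow> C' $$ (i, b j) = (if i = j then 1 else 0)"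
    and minors: "\<And>f. (\<And>j. j < d \<Longrightarrow> f j < n) \<Longrightarrow>
      \<bar>det (select_columns C f)\<bar> = \<bar>det (select_columns C' f)\<bar>"
    and s: "\<And>i. \<bar>s i\<bar> = 1"
    and K: "K \<subseteq> {..<n}" "\<And>i j. i < d \<Longrightarrow> j \<in> K \<Longrightarrow> C' $$ (i, j) = s i * C $$ (i, j) * t j"
    and k: "k < n"
    and R: "R = {(i, i'). i < d \<and> i' < d \<and> (\<exists>c\<in>K. C $$ (i, c) \<noteq> 0 \<and> C $$ (i', c) \<noteq> 0)}"
    and pq: "(p, q) \<in> R\<^sup>*" "p < d" "q < d"
    and p: "C $$ (p, k) \<noteq> 0" "s p * C' $$ (p, k) = C $$ (p, k)"
    and q: "C $$ (q, k) \<noteq> 0" "s q * C' $$ (q, k) = - C $$ (q, k)"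
  shows False
proof -
  have entry: "\<bar>C $$ (i, k)\<bar> = \<bar>C' $$ (i, k)\<bar>" if "i < d" for i
    by (rule abs_entry_eq[OF C b minors that k])
  define plus where "plus i \<longleftrightarrow> i < d \<and> C $$ (i, k) \<noteq> 0 \<and> s i * C' $$ (i, k) = C $$ (i, k)" for i
  define minus where "minus i \<longleftrightarrow> i < d \<and> C $$ (i, k) \<noteq> 0 \<and> s i * C' $$ (i, k) = - C $$ (i, k)" for i
  \<comment> \<open>Entries of column \<open>k\<close> agree in absolute value, so every row meeting
    this column either fits the sign \<open>s\<close> already or needs the opposite one.\<close>
  have pm: "plus i \<or> minus i" if "i < d" "C $$ (i, k) \<noteq> 0" for i
  proof -
    have "s i = 1 \<or> s i = -1" using s[of i] by linarith
    then show ?thesis using entry[OF that(1)] that unfolding plus_def minus_def by (auto simp: abs_eq_iff)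
  qed
  define P where "P l \<longleftrightarrow> (\<exists>x y. (x, y) \<in> R ^^ l \<and> plus x \<and> minus y)" for l
  \<comment> \<open>A path of minimal length over all pairs of rows with opposite signs: by minimality it has no
    chords and column \<open>k\<close> vanishes at its inner rows.\<close>
  define L where "L = (LEAST l. P l)"
  obtain l0 where "(p, q) \<in> R ^^ l0" using pq(1) rtrancl_power by blast
  then have "P l0" using pq p q unfolding P_def plus_def minus_def by blast
  then have PL: "P L" unfolding L_def by (rule LeastI)
  have least: "L \<le> l" if "P l" for l using that unfolding L_def by (rule Least_le)
  obtain x y where xy: "(x, y) \<in> R ^^ L" "plus x" "minus y" using PL unfolding P_def by blast
  obtain r where r: "r 0 = x" "r L = y" "\<And>i. i < L \<Longrightarrow> (r i, r (Suc i)) \<in> R"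
    using xy(1) unfolding relpow_fun_conv by blast
  have L0: "0 < L" using r xy unfolding plus_def minus_def by (cases "L = 0") auto
  have rd: "r m < d" if "m \<le> L" for m
  proof (cases "m < L")
    case True
    then show ?thesis using r(3)[OF True] R by auto
  next
    case False
    then show ?thesis using that r xy unfolding minus_def by auto
  qed
  have from_x: "(x, r i) \<in> R ^^ i" if "i \<le> L" for i
    unfolding relpow_fun_conv using r that by (intro exI[of _ r]) auto
  have to_y: "(r j, y) \<in> R ^^ (L - j)" if "j \<le> L" for j
    unfolding relpow_fun_conv using r that by (intro exI[of _ "\<lambda>i. r (i + j)"]) auto
  \<comment> \<open>An edge from \<open>r i\<close> to \<open>r j\<close> yields a walk of length
    \<open>Suc i + (L - j)\<close> from \<open>x\<close> to \<open>y\<close>, which cannot be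
    shorter than \<open>L\<close>.\<close>
  have shortcut: "j \<le> Suc i" if "i \<le> j" "j \<le> L" "(r i, r j) \<in> R" for i j
  proof -
    have "(x, r j) \<in> R ^^ Suc i" using from_x[of i] that by auto
    then have "(x, y) \<in> R ^^ (Suc i + (L - j))" using to_y[OF that(2)] unfolding relpow_add by blast
    then have "L \<le> Suc i + (L - j)" using least xy unfolding P_def by blast
    then show ?thesis using that by linarith
  qed
  have distinct: "r i \<noteq> r j" if "i < j" "j \<le> L" for i j
  proof
    assume "r i = r j"
    then have "(x, y) \<in> R ^^ (i + (L - j))"
      using to_y[OF that(2)] from_x[of i] that unfolding relpow_add by auto
    then have "L \<le> i + (L - j)" using least xy unfolding P_def by blast
    then show False using that by linarith
  qed
  have inj: "inj_on r {..L}"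
    by (rule linorder_inj_onI) (use distinct in auto)
  have "\<forall>m. \<exists>c. m < L \<longrightarrow> c \<in> K \<and> C $$ (r m, c) \<noteq> 0 \<and> C $$ (r (Suc m), c) \<noteq> 0"
    using r(3) R by blast
  then obtain c where c: "\<And>m. m < L \<Longrightarrow> c m \<in> K" "\<And>m. m < L \<Longrightarrow> C $$ (r m, c m) \<noteq> 0"
    "\<And>m. m < L \<Longrightarrow> C $$ (r (Suc m), c m) \<noteq> 0" by metis
  \<comment> \<open>A nonzero entry of \<open>c m\<close> in row \<open>r i\<close> makes that row
    adjacent to both \<open>r m\<close> and \<open>r (Suc m)\<close>; the bound on shortcuts then
    applies on whichever side \<open>i\<close> lies.\<close>
  have chordless: "i = m \<or> i = Suc m" if "i \<le> L" "m < L" "C $$ (r i, c m) \<noteq> 0" for i m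
  proof -
    have "(r i, r (Suc m)) \<in> R" "(r m, r i) \<in> R"
      using that c[OF that(2)] rd R by auto
    then show ?thesis using shortcut[of i "Suc m"] shortcut[of m i] that by linarith
  qed
  \<comment> \<open>An inner row meeting column \<open>k\<close> would be \<open>plus\<close> or
    \<open>minus\<close>, and together with \<open>y\<close> or \<open>x\<close> respectively would
    give a closer pair of opposite signs.\<close>
  have inner: "C $$ (r m, k) = 0" if "0 < m" "m < L" for m
  proof (rule ccontr)
    assume "C $$ (r m, k) \<noteq> 0"
    then have "plus (r m) \<or> minus (r m)" using that by (intro pm rd) auto
    then consider "plus (r m)" | "minus (r m)" by blast
    then show False
    proof cases
      case 1
      then have "P (L - m)" using to_y[of m] that xy unfolding P_def by auto
      then show False using least[of "L - m"] that by linarith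
    next
      case 2
      then have "P m" using from_x[of m] that xy unfolding P_def by auto
      then show False using least[of m] that by linarith
    qed
  qed
  have inner': "C' $$ (r m, k) = 0" if "0 < m" "m < L" for m
    using inner[OF that] entry[of "r m"] rd[of m] that by simp
  show False
    by (rule no_sign_switching_path[OF C b minors s K k, where r = r and c = c and L = L])
      (use rd inj c chordless inner inner' xy r in \<open>auto simp: plus_def minus_def\<close>)
qed

section \<open>Construction of the row and column signs, column by column\<close>

text \<open>Flipping whole components of rows keeps the earlier columns matched: the support of each
  such column lies in a single component, so the flip is absorbed by its column sign.\<close>

lemma signs_from_abs_minors:
  fixes C C' :: "int mat"
  assumes C: "C \<in> carrier_mat d n" "C' \<in> carrier_mat d n"
    and b: "\<And>j. j < d \<Longrightarrow> b j < n"
      "\<And>i j. i < d \<Longrightarrow> j < d \<Longrightarrow> C $$ (i, b j) = (if i = j then 1 else 0)"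
      "\<And>i j. i < d \<Longrightarrow> j < d \<Longrightarrow> C' $$ (i, b j) = (if i = j then 1 else 0)"
    and minors: "\<And>f. (\<And>j. j < d \<Longrightarrow> f j < n) \<Longrightarrow>
      \<bar>det (select_columns C f)\<bar> = \<bar>det (select_columns C' f)\<bar>"
  shows "\<exists>s t. (\<forall>i. \<bar>s i\<bar> = 1) \<and> (\<forall>j. \<bar>t j\<bar> = 1) \<and>
    (\<forall>i<d. \<forall>j<n. C' $$ (i, j) = s i * C $$ (i, j) * t j)"
proof -
  have "\<exists>s t. (\<forall>i. \<bar>s i\<bar> = 1) \<and> (\<forall>j. \<bar>t j\<bar> = 1) \<and>
    (\<forall>i<d. \<forall>j<k. C' $$ (i, j) = s i * C $$ (i, j) * t j)" if "k \<le> n" for k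
    using that
  proof (induction k)
    case 0
    show ?case by (intro exI[of _ "\<lambda>_. 1"]) simp
  next
    case (Suc k)
    obtain s t :: "nat \<Rightarrow> int" where st: "\<And>i. \<bar>s i\<bar> = 1" "\<And>j. \<bar>t j\<bar> = 1"
      "\<And>i j. i < d \<Longrightarrow> j < k \<Longrightarrow> C' $$ (i, j) = s i * C $$ (i, j) * t j"
      using Suc.IH[OF Suc_leD[OF Suc.prems]] by blast
    have k: "k < n" using Suc.prems by simp
    define R where "R = {(i, i'). i < d \<and> i' < d \<and> (\<exists>c\<in>{..<k}. C $$ (i, c) \<noteq> 0 \<and> C $$ (i', c) \<noteq> 0)}"
    have symR: "sym R" unfolding R_def sym_def by blast
    define minus where "minus i \<longleftrightarrow> i < d \<and> C $$ (i, k) \<noteq> 0 \<and> s i * C' $$ (i, k) = - C $$ (i, k)" for i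
    \<comment> \<open>Exactly the components containing a row with the wrong sign in column
      \<open>k\<close> are flipped. The reflexive closure covers the wrong row itself, even when it
      has no neighbour.\<close>
    define \<epsilon> :: "nat \<Rightarrow> int" where "\<epsilon> i = (if \<exists>i'. (i, i') \<in> R\<^sup>* \<and> minus i' then - 1 else 1)" for i
    have \<epsilon>abs: "\<bar>\<epsilon> i\<bar> = 1" for i by (simp add: \<epsilon>_def)
    have \<epsilon>R: "\<epsilon> i = \<epsilon> i'" if "(i, i') \<in> R" for i i'
    proof -
      have "(i', i) \<in> R" using that symR by (simp add: sym_def)
      then have "(i, x) \<in> R\<^sup>* \<longleftrightarrow> (i', x) \<in> R\<^sup>*" for x
        using that by (meson converse_rtrancl_into_rtrancl)
      then show ?thesis by (simp add: \<epsilon>_def)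
    qed
    \<comment> \<open>A flipped component contains no row whose old sign fits a nonzero entry of
      column \<open>k\<close>, by \<open>no_sign_switch_in_component\<close>. Hence
      \<open>\<epsilon>\<close> corrects this column in every row.\<close>
    have \<epsilon>k: "s i * C' $$ (i, k) = \<epsilon> i * C $$ (i, k)" if i: "i < d" for i
    proof -
      have entry: "\<bar>C $$ (i, k)\<bar> = \<bar>C' $$ (i, k)\<bar>" by (rule abs_entry_eq[OF C b minors i k])
      have "s i = 1 \<or> s i = -1" using st(1)[of i] by linarith
      then have "C $$ (i, k) = 0 \<or> minus i \<or> C $$ (i, k) \<noteq> 0 \<and> s i * C' $$ (i, k) = C $$ (i, k)"
        using entry i by (auto simp: minus_def abs_eq_iff)
      then consider "C $$ (i, k) = 0" | "minus i"
        | "C $$ (i, k) \<noteq> 0" "s i * C' $$ (i, k) = C $$ (i, k)"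
        by blast
      then show ?thesis
      proof cases
        case 1
        then show ?thesis using entry by simp
      next
        case 2
        then have "\<epsilon> i = - 1" by (auto simp: \<epsilon>_def)
        then show ?thesis using 2 by (simp add: minus_def)
      next
        case 3
        have "\<not> (\<exists>i'. (i, i') \<in> R\<^sup>* \<and> minus i')"
        proof
          assume "\<exists>i'. (i, i') \<in> R\<^sup>* \<and> minus i'"
          then obtain i' where i': "(i, i') \<in> R\<^sup>*" "minus i'" by blast
          show False
            by (rule no_sign_switch_in_component[OF C b minors st(1) _ _ k R_def i'(1) i, where t = t])
              (use k 3 i' st(3) in \<open>auto simp: minus_def\<close>)
        qed
        then have "\<epsilon> i = 1" by (simp add: \<epsilon>_def)
        then show ?thesis using 3 by simp
      qed
    qed
    \<comment> \<open>The row chosen by \<open>SOME\<close> is immaterial, as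
      \<open>\<epsilon>\<close> is constant on the support of column \<open>j\<close>. Column
      \<open>k\<close> gets sign \<open>1\<close> because the new row signs already fit it; zero
      columns get \<open>1\<close> as a default.\<close>
    define t' where "t' j = (if j = k then 1 else if \<exists>i<d. C $$ (i, j) \<noteq> 0
      then t j * \<epsilon> (SOME i. i < d \<and> C $$ (i, j) \<noteq> 0) else 1)" for j
    have sq: "s i * s i = 1" "\<epsilon> i * \<epsilon> i = 1" for i
      using st(1)[of i] \<epsilon>abs[of i] by (metis abs_mult_self_eq mult_1)+
    have "\<bar>s i * \<epsilon> i\<bar> = 1" for i by (simp add: abs_mult st \<epsilon>abs)
    moreover have "\<bar>t' j\<bar> = 1" for j by (simp add: t'_def abs_mult st \<epsilon>abs)
    moreover have "C' $$ (i, j) = (s i * \<epsilon> i) * C $$ (i, j) * t' j" if i: "i < d" and j: "j < Suc k" for i j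
    proof (cases "j = k")
      case True
      have "C' $$ (i, k) = (s i * s i) * C' $$ (i, k)" by (simp add: sq)
      also have "\<dots> = s i * (\<epsilon> i * C $$ (i, k))" using \<epsilon>k[OF i] by (simp add: mult.assoc)
      finally show ?thesis using True by (simp add: t'_def)
    next
      case False
      then have jk: "j < k" using j by simp
      show ?thesis
      proof (cases "C $$ (i, j) = 0")
        case True
        then show ?thesis using st(3)[OF i jk] by simp
      next
        case nz: False
        let ?i = "SOME i. i < d \<and> C $$ (i, j) \<noteq> 0"
        have some: "?i < d \<and> C $$ (?i, j) \<noteq> 0" by (rule someI[of _ i]) (use i nz in simp)
        then have "(i, ?i) \<in> R" using i jk nz by (auto simp: R_def)
        then have "t' j = t j * \<epsilon> i" using \<epsilon>R nz i False by (auto simp: t'_def)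
        then have "(s i * \<epsilon> i) * C $$ (i, j) * t' j = s i * C $$ (i, j) * t j * (\<epsilon> i * \<epsilon> i)"
          by (simp add: ac_simps)
        also have "\<dots> = C' $$ (i, j)" using st(3)[OF i jk] sq(2)[of i] by simp
        finally show ?thesis by simp
      qed
    qed
    ultimately show ?case by (intro exI[of _ "\<lambda>i. s i * \<epsilon> i"] exI[of _ t']) blast
  qed
  from this[OF order_refl] show ?thesis .
qed

section \<open>Smith normal form of nonsingular square matrices\<close>

text \<open>Invertibility over the integers is encoded by determinants of absolute value one, which
  makes closure under products and transposition immediate.\<close>

definition unimodular_equiv :: "nat \<Rightarrow> int mat \<Rightarrow> int mat \<Rightarrow> bool" where
  "unimodular_equiv n B S \<longleftrightarrow> (\<exists>P \<in> carrier_mat n n. \<exists>Q \<in> carrier_mat n n.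
     \<bar>det P\<bar> = 1 \<and> \<bar>det Q\<bar> = 1 \<and> S = P * B * Q)"

lemma unimodular_equiv_refl: "B \<in> carrier_mat n n \<Longrightarrow> unimodular_equiv n B B"
  unfolding unimodular_equiv_def by (intro bexI[of _ "1\<^sub>m n"]) auto

lemma unimodular_equiv_carrier:
  "B \<in> carrier_mat n n \<Longrightarrow> unimodular_equiv n B S \<Longrightarrow> S \<in> carrier_mat n n"
  unfolding unimodular_equiv_def by auto

lemma unimodular_equiv_trans:
  assumes B: "B \<in> carrier_mat n n" and "unimodular_equiv n B S" "unimodular_equiv n S T"
  shows "unimodular_equiv n B T"
proof -
  obtain P Q where PQ: "P \<in> carrier_mat n n" "Q \<in> carrier_mat n n"
    "\<bar>det P\<bar> = 1" "\<bar>det Q\<bar> = 1" "S = P * B * Q"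
    using assms(2) unfolding unimodular_equiv_def by blast
  obtain P' Q' where PQ': "P' \<in> carrier_mat n n" "Q' \<in> carrier_mat n n"
    "\<bar>det P'\<bar> = 1" "\<bar>det Q'\<bar> = 1" "T = P' * S * Q'"
    using assms(3) unfolding unimodular_equiv_def by blast
  have "T = P' * (P * B * Q * Q')"
    using PQ PQ' B by (simp add: assoc_mult_mat[of _ n n _ n _ n])
  also have "\<dots> = (P' * P) * B * (Q * Q')"
    using PQ PQ' B by (simp add: assoc_mult_mat[of _ n n _ n _ n])
  finally have "T = (P' * P) * B * (Q * Q')" .
  moreover have "\<bar>det (P' * P)\<bar> = 1" "\<bar>det (Q * Q')\<bar> = 1"
    using PQ PQ' by (simp_all add: det_mult[of _ n] abs_mult)
  ultimately show ?thesis unfolding unimodular_equiv_def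
    using PQ(1,2) PQ'(1,2) mult_carrier_mat by blast
qed

lemma unimodular_equiv_left:
  assumes "B \<in> carrier_mat n n" "P \<in> carrier_mat n n" "\<bar>det P\<bar> = 1"
  shows "unimodular_equiv n B (P * B)"
  unfolding unimodular_equiv_def using assms
  by (intro bexI[of _ P] bexI[of _ "1\<^sub>m n"]) auto

lemma unimodular_equiv_transpose:
  assumes "B \<in> carrier_mat n n" "unimodular_equiv n B\<^sup>T S"
  shows "unimodular_equiv n B S\<^sup>T"
proof -
  obtain P Q where PQ: "P \<in> carrier_mat n n" "Q \<in> carrier_mat n n"
    "\<bar>det P\<bar> = 1" "\<bar>det Q\<bar> = 1" "S = P * B\<^sup>T * Q"
    using assms(2) unfolding unimodular_equiv_def by blast
  have "S\<^sup>T = Q\<^sup>T * B * P\<^sup>T"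
    using PQ(1,2) assms(1) unfolding PQ(5)
    by (simp add: transpose_mult[of _ n n _ n] assoc_mult_mat[of _ n n _ n _ n])
  then show ?thesis unfolding unimodular_equiv_def
    using PQ by (intro bexI[of _ "Q\<^sup>T"] bexI[of _ "P\<^sup>T"]) (auto simp: det_transpose[of _ n])
qed

lemma unimodular_equiv_abs_det:
  assumes "B \<in> carrier_mat n n" "unimodular_equiv n B S"
  shows "\<bar>det S\<bar> = \<bar>det B\<bar>"
proof -
  obtain P Q where "P \<in> carrier_mat n n" "Q \<in> carrier_mat n n"
    "\<bar>det P\<bar> = 1" "\<bar>det Q\<bar> = 1" "S = P * B * Q"
    using assms(2) unfolding unimodular_equiv_def by blast
  then show ?thesis using assms(1) by (simp add: det_mult[of _ n] abs_mult)
qed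

text \<open>One lower triangular matrix with unit diagonal changes all rows below the first
  simultaneously, so a whole column can be reduced in a single step.\<close>

lemma unimodular_equiv_add_row0:
  assumes B: "B \<in> carrier_mat n n"
  shows "unimodular_equiv n B
    (mat n n (\<lambda>(i, j). B $$ (i, j) + (if i = 0 then 0 else x i * B $$ (0, j))))"
proof -
  define P where "P = mat n n (\<lambda>(i, j). if i = j then 1 else if j = 0 then x i else (0::int))"
  have P: "P \<in> carrier_mat n n" by (simp add: P_def)
  have diag: "diag_mat P = replicate n 1"
    by (rule nth_equalityI) (auto simp: diag_mat_def P_def)
  have "det P = prod_list (diag_mat P)"
    by (rule det_lower_triangular[OF _ P]) (auto simp: P_def)
  then have "det P = 1" by (simp add: diag)
  moreover have "P * B = mat n n (\<lambda>(i, j). B $$ (i, j) + (if i = 0 then 0 else x i * B $$ (0, j)))"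
  proof (intro eq_matI)
    fix i j
    assume "i < dim_row (mat n n (\<lambda>(i, j). B $$ (i, j) + (if i = 0 then 0 else x i * B $$ (0, j))))"
      "j < dim_col (mat n n (\<lambda>(i, j). B $$ (i, j) + (if i = 0 then 0 else x i * B $$ (0, j))))"
    then have ij: "i < n" "j < n" by simp_all
    have "(P * B) $$ (i, j) = (\<Sum>k<n. P $$ (i, k) * B $$ (k, j))"
      by (rule index_mult_mat_sum[OF P B ij])
    \<comment> \<open>For \<open>i = 0\<close> this index set collapses to one element, hence the
      case distinction that follows.\<close>
    also have "\<dots> = (\<Sum>k\<in>{i, 0}. P $$ (i, k) * B $$ (k, j))"
      by (rule sum.mono_neutral_right) (use ij in \<open>auto simp: P_def\<close>)
    finally show "(P * B) $$ (i, j) =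
        mat n n (\<lambda>(i, j). B $$ (i, j) + (if i = 0 then 0 else x i * B $$ (0, j))) $$ (i, j)"
      using ij by (cases "i = 0") (auto simp: P_def)
  qed (use P B in auto)
  ultimately show ?thesis using unimodular_equiv_left[OF B P] by simp
qed

lemma unimodular_equiv_add_col0:
  assumes B: "B \<in> carrier_mat n n"
  shows "unimodular_equiv n B
    (mat n n (\<lambda>(i, j). B $$ (i, j) + (if j = 0 then 0 else x j * B $$ (i, 0))))"
proof -
  have "unimodular_equiv n B
    (mat n n (\<lambda>(i, j). B\<^sup>T $$ (i, j) + (if i = 0 then 0 else x i * B\<^sup>T $$ (0, j))))\<^sup>T"
    using B by (intro unimodular_equiv_transpose[OF B] unimodular_equiv_add_row0) auto
  also have "(mat n n (\<lambda>(i, j). B\<^sup>T $$ (i, j) + (if i = 0 then 0 else x i * B\<^sup>T $$ (0, j))))\<^sup>T =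
    mat n n (\<lambda>(i, j). B $$ (i, j) + (if j = 0 then 0 else x j * B $$ (i, 0)))"
    using B by (intro eq_matI) auto
  finally show ?thesis .
qed

lemma unimodular_equiv_move_row:
  assumes B: "B \<in> carrier_mat n n" and k: "k < n"
  shows "\<exists>S. unimodular_equiv n B S \<and> (\<forall>j<n. S $$ (0, j) = B $$ (k, j))"
proof (cases "k = 0")
  case True
  then show ?thesis using unimodular_equiv_refl[OF B] by blast
next
  case False
  have "unimodular_equiv n B (swaprows_mat n 0 k * B)"
    by (rule unimodular_equiv_left[OF B]) (use k False in \<open>auto simp: det_swaprows_mat\<close>)
  moreover have "swaprows_mat n 0 k * B = swaprows 0 k B"
    using swaprows_mat[OF B, of 0 k] k by simp
  ultimately show ?thesis using B k by (intro exI[of _ "swaprows 0 k B"]) auto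
qed

text \<open>Two row moves, one of them on the transpose, bring the entry to the corner; if it is
  negative, the whole matrix is multiplied by \<open>-1\<close>.\<close>

lemma unimodular_equiv_move_entry:
  assumes B: "B \<in> carrier_mat n n" and k: "k < n" and l: "l < n"
  shows "\<exists>S. unimodular_equiv n B S \<and> S $$ (0, 0) = \<bar>B $$ (k, l)\<bar>"
proof -
  obtain S where S: "unimodular_equiv n B S" "S $$ (0, l) = B $$ (k, l)"
    using unimodular_equiv_move_row[OF B k] l by blast
  have Sc: "S \<in> carrier_mat n n" using unimodular_equiv_carrier[OF B S(1)] .
  obtain T where T: "unimodular_equiv n S\<^sup>T T" "T $$ (0, 0) = S\<^sup>T $$ (l, 0)"
    using unimodular_equiv_move_row[of "S\<^sup>T" n l] l Sc by auto
  have Tc: "T \<in> carrier_mat n n" using unimodular_equiv_carrier[OF _ T(1)] Sc by simp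
  have BT: "unimodular_equiv n B T\<^sup>T"
    by (rule unimodular_equiv_trans[OF B S(1) unimodular_equiv_transpose[OF Sc T(1)]])
  have e: "T\<^sup>T $$ (0, 0) = B $$ (k, l)" using T(2) S(2) Tc Sc l by auto
  have "unimodular_equiv n T\<^sup>T ((-1 \<cdot>\<^sub>m 1\<^sub>m n) * T\<^sup>T)"
    by (rule unimodular_equiv_left) (use Tc in \<open>auto simp: power_abs\<close>)
  then have BT': "unimodular_equiv n B ((-1 \<cdot>\<^sub>m 1\<^sub>m n) * T\<^sup>T)"
    using unimodular_equiv_trans[OF B BT] by blast
  have "(-1 \<cdot>\<^sub>m 1\<^sub>m n) * T\<^sup>T = -1 \<cdot>\<^sub>m T\<^sup>T"
    using Tc by (subst mult_smult_assoc_mat[of _ n n _ n]) auto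
  then have "((-1 \<cdot>\<^sub>m 1\<^sub>m n) * T\<^sup>T) $$ (0, 0) = - (B $$ (k, l))"
    using Tc k e by simp
  then show ?thesis using BT BT' e by (cases "B $$ (k, l) \<ge> 0") auto
qed

section \<open>Existence of the Smith normal form\<close>

text \<open>The corner is the smallest positive value \<open>a\<close> that occurs up to sign in any
  equivalent matrix. Any remainder modulo \<open>a\<close> that can be produced as an entry must
  therefore vanish; this clears the first row and column and yields divisibility of the
  rest.\<close>

lemma exists_smith_form:
  assumes "B \<in> carrier_mat n n" "det B \<noteq> 0"
  shows "\<exists>S. unimodular_equiv n B S \<and> (\<forall>i<n. \<forall>j<n. i \<noteq> j \<longrightarrow> S $$ (i, j) = 0) \<and>
    (\<forall>i<n. 0 \<le> S $$ (i, i)) \<and> (\<forall>i. Suc i < n \<longrightarrow> S $$ (i, i) dvd S $$ (Suc i, Suc i))"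
  using assms
proof (induction n arbitrary: B)
  case 0
  then show ?case using unimodular_equiv_refl[of B 0] by auto
next
  case (Suc n)
  let ?N = "Suc n"
  note B = Suc.prems(1)
  define V where "V = {x::nat. 0 < x \<and> (\<exists>S. unimodular_equiv ?N B S \<and> S $$ (0, 0) = int x)}"
  have V: "nat \<bar>S $$ (i, j)\<bar> \<in> V" if h: "unimodular_equiv ?N B S" "i < ?N" "j < ?N" "S $$ (i, j) \<noteq> 0" for S i j
  proof -
    have Sc: "S \<in> carrier_mat ?N ?N" using unimodular_equiv_carrier[OF B h(1)] .
    obtain T where "unimodular_equiv ?N S T" "T $$ (0, 0) = \<bar>S $$ (i, j)\<bar>"
      using unimodular_equiv_move_entry[OF Sc h(2,3)] by blast
    then show ?thesis using unimodular_equiv_trans[OF B h(1)] h(4) by (auto simp: V_def)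
  qed
  have "\<exists>i<?N. \<exists>j<?N. B $$ (i, j) \<noteq> 0"
  proof (rule ccontr)
    assume "\<not> ?thesis"
    then have "B = 0\<^sub>m ?N ?N" using B by (intro eq_matI) auto
    then show False using Suc.prems(2) by simp
  qed
  then obtain x where "x \<in> V" using V[OF unimodular_equiv_refl[OF B]] by blast
  \<comment> \<open>The least positive absolute value of an entry of any matrix equivalent to \<open>B\<close>.\<close>
  define m where "m = (LEAST x. x \<in> V)"
  define a where "a = int m"
  have mV: "m \<in> V" unfolding m_def using \<open>x \<in> V\<close> by (rule LeastI)
  have a: "0 < a" using mV by (simp add: V_def a_def)
  have small: "S $$ (i, j) = 0"
    if "unimodular_equiv ?N B S" "i < ?N" "j < ?N" "0 \<le> S $$ (i, j)" "S $$ (i, j) < a" for S i j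
  proof (rule ccontr)
    assume nz: "S $$ (i, j) \<noteq> 0"
    have "m \<le> nat \<bar>S $$ (i, j)\<bar>"
      unfolding m_def by (rule Least_le[of "\<lambda>x. x \<in> V", OF V[OF that(1-3) nz]])
    then show False using that(4,5) by (simp add: a_def)
  qed
  have modz: "S $$ (i, j) = 0"
    if "unimodular_equiv ?N B S" "i < ?N" "j < ?N" "S $$ (i, j) = y mod a" for S i j y
    by (rule small[OF that(1-3)]) (use that(4) a in auto)
  \<comment> \<open>Adding the first row to the others puts \<open>a\<close> at
    \<open>(i, 0)\<close> and leaves \<open>(i, j)\<close> unchanged, as the first row is zero
    there. Subtracting a multiple of the first column then leaves the remainder modulo
    \<open>a\<close> at \<open>(i, j)\<close>.\<close>
  have divides: "a dvd S $$ (i, j)"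
    if S: "unimodular_equiv ?N B S" "S $$ (0, 0) = a"
      "\<And>j. 0 < j \<Longrightarrow> j < ?N \<Longrightarrow> S $$ (0, j) = 0" "\<And>i. 0 < i \<Longrightarrow> i < ?N \<Longrightarrow> S $$ (i, 0) = 0"
      and ij: "0 < i" "i < ?N" "0 < j" "j < ?N" for S i j
  proof -
    have Sc: "S \<in> carrier_mat ?N ?N" using unimodular_equiv_carrier[OF B S(1)] .
    define S2 where "S2 = mat ?N ?N (\<lambda>(k, l). S $$ (k, l) + (if k = 0 then 0 else 1 * S $$ (0, l)))"
    have S2: "unimodular_equiv ?N B S2" unfolding S2_def
      by (rule unimodular_equiv_trans[OF B S(1) unimodular_equiv_add_row0[OF Sc, where x = "\<lambda>_. 1"]])
    have S2c: "S2 \<in> carrier_mat ?N ?N" by (simp add: S2_def)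
    define S3 where "S3 = mat ?N ?N (\<lambda>(k, l). S2 $$ (k, l) +
      (if l = 0 then 0 else - (S $$ (i, j) div a) * S2 $$ (k, 0)))"
    have S3: "unimodular_equiv ?N B S3" unfolding S3_def
      by (rule unimodular_equiv_trans[OF B S2 unimodular_equiv_add_col0[OF S2c]])
    have "S2 $$ (i, j) = S $$ (i, j)" "S2 $$ (i, 0) = a" using ij S by (simp_all add: S2_def)
    then have e: "S3 $$ (i, j) = S $$ (i, j) mod a"
      using ij by (simp add: S3_def minus_div_mult_eq_mod[symmetric])
    then have "S3 $$ (i, j) = 0" by (rule modz[OF S3 ij(2,4)])
    then show ?thesis using e by (simp add: dvd_eq_mod_eq_0)
  qed
  obtain S1 where S1: "unimodular_equiv ?N B S1" "S1 $$ (0, 0) = a"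
    using mV by (auto simp: V_def a_def)
  have S1c: "S1 \<in> carrier_mat ?N ?N" using unimodular_equiv_carrier[OF B S1(1)] .
  \<comment> \<open>The first column is cleared below the corner. Clearing the first row afterwards
    leaves that column untouched.\<close>
  define S2 where "S2 = mat ?N ?N (\<lambda>(k, l). S1 $$ (k, l) +
    (if k = 0 then 0 else - (S1 $$ (k, 0) div a) * S1 $$ (0, l)))"
  have S2: "unimodular_equiv ?N B S2" unfolding S2_def
    by (rule unimodular_equiv_trans[OF B S1(1)
          unimodular_equiv_add_row0[OF S1c, where x = "\<lambda>k. - (S1 $$ (k, 0) div a)"]])
  have S2c: "S2 \<in> carrier_mat ?N ?N" by (simp add: S2_def)
  have S2a: "S2 $$ (0, 0) = a" using S1 by (simp add: S2_def)
  have S2col: "S2 $$ (i, 0) = 0" if "0 < i" "i < ?N" for i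
    by (rule modz[OF S2 that(2), where y = "S1 $$ (i, 0)"])
      (use that S1 in \<open>auto simp: S2_def minus_div_mult_eq_mod[symmetric]\<close>)
  define S3 where "S3 = mat ?N ?N (\<lambda>(k, l). S2 $$ (k, l) +
    (if l = 0 then 0 else - (S2 $$ (0, l) div a) * S2 $$ (k, 0)))"
  have S3: "unimodular_equiv ?N B S3" unfolding S3_def
    by (rule unimodular_equiv_trans[OF B S2
          unimodular_equiv_add_col0[OF S2c, where x = "\<lambda>l. - (S2 $$ (0, l) div a)"]])
  have S3c: "S3 \<in> carrier_mat ?N ?N" by (simp add: S3_def)
  have S3a: "S3 $$ (0, 0) = a" using S2a by (simp add: S3_def)
  have S3col: "S3 $$ (i, 0) = 0" if "0 < i" "i < ?N" for i
    using S2col that by (simp add: S3_def)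
  have S3row: "S3 $$ (0, j) = 0" if "0 < j" "j < ?N" for j
    by (rule modz[OF S3 _ that(2), where y = "S2 $$ (0, j)"])
      (use that S2a in \<open>auto simp: S3_def minus_div_mult_eq_mod[symmetric]\<close>)
  define block where "block M = four_block_mat (mat 1 1 (\<lambda>_. a)) (0\<^sub>m 1 n) (0\<^sub>m n 1) M" for M
  define D where "D = mat n n (\<lambda>(i, j). S3 $$ (Suc i, Suc j))"
  have D: "D \<in> carrier_mat n n" by (simp add: D_def)
  have S3D: "S3 = block D"
    using S3c S3a S3col S3row by (intro eq_matI) (auto simp: block_def D_def)
  have "det S3 = a * det D"
    unfolding S3D block_def
    by (subst det_four_block_mat_lower_left_zero[of _ 1 _ n]) (auto simp: D det_single)
  then have "det D \<noteq> 0" using unimodular_equiv_abs_det[OF B S3] Suc.prems(2) by auto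
  from Suc.IH[OF D this] obtain T where T: "unimodular_equiv n D T"
    "\<And>i j. i < n \<Longrightarrow> j < n \<Longrightarrow> i \<noteq> j \<Longrightarrow> T $$ (i, j) = 0"
    "\<And>i. i < n \<Longrightarrow> 0 \<le> T $$ (i, i)" "\<And>i. Suc i < n \<Longrightarrow> T $$ (i, i) dvd T $$ (Suc i, Suc i)"
    by blast
  obtain P Q where PQ: "P \<in> carrier_mat n n" "Q \<in> carrier_mat n n"
    "\<bar>det P\<bar> = 1" "\<bar>det Q\<bar> = 1" "T = P * D * Q"
    using T(1) unfolding unimodular_equiv_def by blast
  have Tc: "T \<in> carrier_mat n n" using unimodular_equiv_carrier[OF D T(1)] .
  \<comment> \<open>Transformations of the lower block extend by a corner \<open>1\<close>, with the
    same determinant, to transformations that fix the corner \<open>a\<close>.\<close>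
  define ext where "ext M = four_block_mat (1\<^sub>m 1) (0\<^sub>m 1 n) (0\<^sub>m n 1) M" for M :: "int mat"
  have extc: "ext M \<in> carrier_mat ?N ?N" if "M \<in> carrier_mat n n" for M
    using that four_block_carrier_mat[of "1\<^sub>m 1 :: int mat" 1 1 M n n] by (simp add: ext_def)
  have extdet: "det (ext M) = det M" if "M \<in> carrier_mat n n" for M
    unfolding ext_def using that
    by (subst det_four_block_mat_lower_left_zero[of _ 1 _ n]) auto
  have "block T = ext P * block D * ext Q"
    unfolding block_def ext_def PQ(5) using PQ(1,2) D
    by (simp add: mult_four_block_mat[of _ 1 1 _ n _ n _ _ 1 _ n])
  then have "unimodular_equiv ?N S3 (block T)"
    unfolding unimodular_equiv_def S3D using PQ extc extdet
    by (intro bexI[of _ "ext P"] bexI[of _ "ext Q"]) auto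
  then have BT: "unimodular_equiv ?N B (block T)" by (rule unimodular_equiv_trans[OF B S3])
  have entry: "block T $$ (i, j) =
      (if i = 0 \<and> j = 0 then a else if i = 0 \<or> j = 0 then 0 else T $$ (i - 1, j - 1))"
    if "i < ?N" "j < ?N" for i j
    using that Tc by (auto simp: block_def)
  \<comment> \<open>At \<open>i = 0\<close> the divisibility comes from minimality of
    \<open>a\<close>, applied to \<open>block T\<close> itself; further down it comes from the
    induction hypothesis.\<close>
  have "block T $$ (i, i) dvd block T $$ (Suc i, Suc i)" if "Suc i < ?N" for i
  proof (cases i)
    case 0
    then show ?thesis
      using divides[OF BT, of 1 1] that by (simp add: entry)
  next
    case (Suc k)
    then show ?thesis using that T(4)[of k] by (simp add: entry)
  qed
  then show ?case using BT a T(2,3) by (intro exI[of _ "block T"]) (auto simp: entry)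
qed

section \<open>Maximal minors and the arithmetic matroid\<close>

text \<open>Such a determinant is its own inverse, so \<open>det P\<close> times the adjugate is an
  integral inverse.\<close>

lemma invertible_mat_if_abs_det:
  fixes P :: "int mat"
  assumes P: "P \<in> carrier_mat n n" and "\<bar>det P\<bar> = 1"
  shows "invertible_mat P"
proof -
  have sq: "det P * det P = 1" using assms(2) by (metis abs_mult_self_eq mult_1)
  note adj = adj_mat[OF P]
  let ?Q = "det P \<cdot>\<^sub>m adj_mat P"
  have "P * ?Q = 1\<^sub>m n" "?Q * P = 1\<^sub>m n"
    using P adj sq by (auto simp: mult_smult_distrib[of _ n n _ n] mult_smult_assoc_mat[of _ n n _ n]
        intro!: eq_matI)
  then show ?thesis using P adj(1) unfolding invertible_mat_def inverts_mat_def by auto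
qed

lemma abs_det_if_invertible_mat:
  fixes P :: "int mat"
  assumes P: "P \<in> carrier_mat n n" and "invertible_mat P"
  shows "\<bar>det P\<bar> = 1"
proof -
  obtain Q where Q: "P * Q = 1\<^sub>m (dim_row P)" "Q * P = 1\<^sub>m (dim_row Q)"
    using assms(2) unfolding invertible_mat_def inverts_mat_def by blast
  have Qc: "Q \<in> carrier_mat n n"
    using arg_cong[OF Q(1), of dim_col] arg_cong[OF Q(2), of dim_col] P by auto
  have "det P * det Q = 1" using Q(1) P det_mult[OF P Qc] by simp
  then show ?thesis using abs_zmult_eq_1[of "det P" "det Q"] by simp
qed

text \<open>Existence makes the chosen matrix satisfy the specification, and every matrix satisfying
  it has the absolute determinant of \<open>B\<close>. That being nonzero, no diagonal entry is left
  out of the product.\<close>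

lemma invariant_factor_product_nonsingular:
  assumes B: "B \<in> carrier_mat n n" and nz: "det B \<noteq> 0"
  shows "int (invariant_factor_product B) = \<bar>det B\<bar>"
proof -
  obtain S where S: "unimodular_equiv n B S" "\<forall>i<n. \<forall>j<n. i \<noteq> j \<longrightarrow> S $$ (i, j) = 0"
    "\<forall>i<n. 0 \<le> S $$ (i, i)" "\<forall>i. Suc i < n \<longrightarrow> S $$ (i, i) dvd S $$ (Suc i, Suc i)"
    using exists_smith_form[OF B nz] by blast
  have Sc: "S \<in> carrier_mat n n" using unimodular_equiv_carrier[OF B S(1)] .
  obtain P Q where PQ: "P \<in> carrier_mat n n" "Q \<in> carrier_mat n n"
    "\<bar>det P\<bar> = 1" "\<bar>det Q\<bar> = 1" "S = P * B * Q"
    using S(1) unfolding unimodular_equiv_def by blast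
  have "smith_normal_form_of B S"
    unfolding smith_normal_form_of_def diagonal_mat_def
  proof (intro conjI)
    show "\<exists>P\<in>carrier_mat (dim_row B) (dim_row B). \<exists>Q\<in>carrier_mat (dim_col B) (dim_col B).
        invertible_mat P \<and> invertible_mat Q \<and> S = P * B * Q"
      using PQ B invertible_mat_if_abs_det[OF PQ(1,3)] invertible_mat_if_abs_det[OF PQ(2,4)] by auto
  qed (use S Sc B in auto)
  define T where "T = smith_normal_form B"
  have T: "smith_normal_form_of B T"
    unfolding T_def smith_normal_form_def by (rule someI[of "smith_normal_form_of B", OF \<open>smith_normal_form_of B S\<close>])
  then obtain P Q where PQ: "P \<in> carrier_mat n n" "Q \<in> carrier_mat n n"
    "invertible_mat P" "invertible_mat Q" "T = P * B * Q"
    using B unfolding smith_normal_form_of_def by auto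
  have Tc: "T \<in> carrier_mat n n" and Td: "diagonal_mat T" and Tn: "\<And>i. i < n \<Longrightarrow> 0 \<le> T $$ (i, i)"
    using T B unfolding smith_normal_form_of_def by auto
  have "\<bar>det T\<bar> = \<bar>det B\<bar>"
    using PQ B abs_det_if_invertible_mat[OF PQ(1,3)] abs_det_if_invertible_mat[OF PQ(2,4)]
    by (simp add: det_mult[of _ n] abs_mult)
  moreover have detT: "det T = (\<Prod>i<n. T $$ (i, i))"
  proof -
    have "det T = prod_list (diag_mat T)"
      by (rule det_upper_triangular[OF _ Tc]) (use Td Tc in \<open>auto simp: diagonal_mat_def\<close>)
    then show ?thesis using Tc by (simp add: prod_list_diag_prod atLeast0LessThan)
  qed
  moreover have "(\<Prod>i<n. T $$ (i, i)) \<noteq> 0" 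
  proof
    assume "(\<Prod>i<n. T $$ (i, i)) = 0"
    then have "\<bar>det B\<bar> = 0" using calculation by (simp only: abs_zero)
    then show False using nz by simp
  qed
  ultimately have "T $$ (i, i) \<noteq> 0" if "i < n" for i using that by auto
  then have "{i. i < min (dim_row T) (dim_col T) \<and> T $$ (i, i) \<noteq> 0} = {..<n}" using Tc by auto
  then have "invariant_factor_product B = nat (det T)"
    unfolding invariant_factor_product_def T_def[symmetric] Let_def detT by simp
  moreover have "0 \<le> det T" unfolding detT using Tn by (intro prod_nonneg) auto
  ultimately show ?thesis using \<open>\<bar>det T\<bar> = \<bar>det B\<bar>\<close> by simp
qed

section \<open>Maximal minors determined by the arithmetic matroid\<close>

lemma abs_det_select_columns_image_eq:
  fixes A :: "int mat"
  assumes A: "A \<in> carrier_mat d n" and f: "inj_on f {..<d}" and g: "inj_on g {..<d}"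
    and im: "f ` {..<d} = g ` {..<d}"
  shows "\<bar>det (select_columns A f)\<bar> = \<bar>det (select_columns A g)\<bar>"
proof -
  \<comment> \<open>The permutation relating the two enumerations, extended by the identity beyond
    \<open>d\<close> as \<open>permutes\<close> demands.\<close>
  define p where "p j = (if j < d then the_inv_into {..<d} g (f j) else j)" for j
  have gp: "g (p j) = f j" "p j < d" if "j < d" for j
  proof -
    have "f j \<in> g ` {..<d}" using that im by blast
    then show "g (p j) = f j" "p j < d"
      using that f_the_inv_into_f[OF g, of "f j"] the_inv_into_into[OF g, of "f j" "{..<d}"]
      by (auto simp: p_def)
  qed
  have "inj_on p {0..<d}"
  proof (rule inj_onI)
    fix i j assume "i \<in> {0..<d}" "j \<in> {0..<d}" "p i = p j"
    then show "i = j" using gp(1)[of i] gp(1)[of j] f by (auto simp: inj_on_def)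
  qed
  moreover have "p ` {0..<d} \<subseteq> {0..<d}" using gp by auto
  ultimately have "bij_betw p {0..<d} {0..<d}"
    by (simp add: bij_betw_def endo_inj_surj)
  then have p: "p permutes {0..<d}" by (rule bij_imp_permutes) (simp add: p_def)
  let ?G = "(select_columns A g)\<^sup>T"
  have "(select_columns A f)\<^sup>T = mat d d (\<lambda>(i, j). ?G $$ (p i, j))"
    using A gp by (intro eq_matI) (auto simp: select_columns_def)
  moreover have "det (mat d d (\<lambda>(i, j). ?G $$ (p i, j))) = signof p * det ?G"
    using A by (intro det_permute_rows[OF _ p]) auto
  ultimately have "det ((select_columns A f)\<^sup>T) = signof p * det ?G" by simp
  then have "det (select_columns A f) = signof p * det (select_columns A g)"
    unfolding det_transpose[OF select_columns_carrier[OF A]] .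
  then show ?thesis by (simp add: abs_mult sign_def)
qed

lemma det_select_columns_not_inj:
  fixes A :: "int mat"
  assumes A: "A \<in> carrier_mat d n" and "\<not> inj_on f {..<d}"
  shows "det (select_columns A f) = 0"
proof -
  obtain i j where "i < d" "j < d" "i \<noteq> j" "f i = f j" using assms(2) by (auto simp: inj_on_def)
  then show ?thesis
    using A by (intro det_identical_columns[of _ d i j]) (auto simp: select_columns_def intro!: eq_vecI)
qed

text \<open>Injectivity of the column map on the index set amounts to distinct columns of the
  selected square matrix; distinct independent columns mean full rank over the rationals.\<close>

lemma columns_indep_iff_det:
  fixes A :: "int mat"
  assumes A: "A \<in> carrier_mat d n" and f: "inj_on f {..<d}" "\<And>j. j < d \<Longrightarrow> f j < n"
  shows "columns_indep A (f ` {..<d}) \<longleftrightarrow> det (select_columns A f) \<noteq> 0"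
proof -
  interpret vec_space "TYPE(rat)" d .
  let ?R = "map_mat rat_of_int A"
  let ?M = "map_mat rat_of_int (select_columns A f)"
  have M: "?M \<in> carrier_mat d d" using A by simp
  have col: "col ?M j = col ?R (f j)" if "j < d" for j
    using that A f(2)[OF that] by (intro eq_vecI) (auto simp: select_columns_def)
  have set: "set (cols ?M) = col ?R ` f ` {..<d}"
  proof -
    have "set (cols ?M) = col ?M ` {..<d}"
      using M unfolding cols_def by (simp add: atLeast0LessThan)
    then show ?thesis using col by (force simp: image_image)
  qed
  have dist: "distinct (cols ?M) \<longleftrightarrow> inj_on (col ?R) (f ` {..<d})"
  proof -
    have "distinct (cols ?M) \<longleftrightarrow> inj_on (col ?M) {..<d}"
      using M unfolding cols_def by (simp add: distinct_map atLeast0LessThan)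
    also have "\<dots> \<longleftrightarrow> inj_on (col ?R \<circ> f) {..<d}"
      by (rule inj_on_cong) (simp add: col)
    finally show ?thesis by (simp only: comp_inj_on_iff[OF f(1)])
  qed
  have det: "det ?M = rat_of_int (det (select_columns A f))"
    by (rule of_int_hom.hom_det)
  have "columns_indep A (f ` {..<d}) \<longleftrightarrow> distinct (cols ?M) \<and> lin_indpt (set (cols ?M))"
    using A unfolding columns_indep_def dist set by simp
  also have "\<dots> \<longleftrightarrow> det ?M \<noteq> 0"
  proof
    assume "distinct (cols ?M) \<and> lin_indpt (set (cols ?M))"
    then show "det ?M \<noteq> 0" using lin_indpt_full_rank[OF M] det_rank_iff[OF M] by blast
  next
    assume nz: "det ?M \<noteq> 0"
    have "distinct (cols ?M)"
      using nz det_identical_columns[OF M] M by (auto simp: distinct_conv_nth)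
    then show "distinct (cols ?M) \<and> lin_indpt (set (cols ?M))"
      using nz full_rank_lin_indpt[OF M] det_rank_iff[OF M] by blast
  qed
  finally show ?thesis using det by simp
qed

text \<open>Passes from index sets to sets of vectors: the columns of a matroid basis form a maximal
  independent set of column vectors, whose size is the rank.\<close>

lemma is_basis_card:
  fixes A :: "int mat"
  assumes A: "A \<in> carrier_mat d n" and rank: "vec_space.rank d (map_mat rat_of_int A) = r"
    and basis: "is_basis (arith_matroid_of A) B"
  shows "card B = r"
proof -
  interpret vec_space "TYPE(rat)" d .
  let ?R = "map_mat rat_of_int A"
  have R: "?R \<in> carrier_mat d n" using A by simp
  have cols: "set (cols ?R) = col ?R ` {..<n}"
    using R unfolding cols_def by (simp add: atLeast0LessThan)
  have indep: "I \<in> indep (arith_matroid_of A) \<longleftrightarrow>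
      I \<subseteq> {..<n} \<and> inj_on (col ?R) I \<and> lin_indpt (col ?R ` I)" for I
    using A by (simp add: arith_matroid_of_def columns_indep_def)
  have B: "B \<subseteq> {..<n}" "inj_on (col ?R) B" "lin_indpt (col ?R ` B)"
    and Bmax: "\<And>J. J \<in> indep (arith_matroid_of A) \<Longrightarrow> B \<subseteq> J \<Longrightarrow> J = B"
    using basis indep unfolding is_basis_def by auto
  have "maximal (col ?R ` B) (\<lambda>T. T \<subseteq> set (cols ?R) \<and> lin_indpt T)"
    unfolding maximal_def
  proof (intro conjI allI impI)
    show "col ?R ` B \<subseteq> set (cols ?R)" using B(1) cols by auto
    show "lin_indpt (col ?R ` B)" by fact
    fix T assume T: "col ?R ` B \<subseteq> T \<and> T \<subseteq> set (cols ?R) \<and> lin_indpt T"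
    \<comment> \<open>One index is chosen for each vector of \<open>T\<close> outside the span of
      indices \<open>B\<close> already provides as columns, so \<open>J\<close> stays injective and
      contains \<open>B\<close>; maximality of \<open>B\<close> then forces \<open>T\<close> to be
      its set of columns.\<close>
    define J where "J = B \<union> inv_into {..<n} (col ?R) ` (T - col ?R ` B)"
    have TB: "T - col ?R ` B \<subseteq> col ?R ` {..<n}" using T cols by auto
    have J: "J \<subseteq> {..<n}" using B(1) TB inv_into_into[of _ "col ?R" "{..<n}"] by (auto simp: J_def)
    have inv: "col ?R (inv_into {..<n} (col ?R) x) = x" if "x \<in> T - col ?R ` B" for x
      using that TB by (intro f_inv_into_f) auto
    have im: "col ?R ` J = T" using T inv by (force simp: J_def image_Un image_image)
    have "inj_on (col ?R) J"
      unfolding J_def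
    proof (subst inj_on_Un, intro conjI)
      show "inj_on (col ?R) (inv_into {..<n} (col ?R) ` (T - col ?R ` B))"
        by (rule inj_onI) (use inv in auto)
      show "col ?R ` (B - inv_into {..<n} (col ?R) ` (T - col ?R ` B)) \<inter>
          col ?R ` (inv_into {..<n} (col ?R) ` (T - col ?R ` B) - B) = {}"
        using inv by auto
    qed (use B in auto)
    then have "J \<in> indep (arith_matroid_of A)" using indep J im T by simp
    then have "J = B" by (rule Bmax) (simp add: J_def)
    then show "T = col ?R ` B" using im by simp
  qed
  then have "rank ?R = card (col ?R ` B)" by (rule rank_card_indpt[OF R])
  then show ?thesis using rank card_image[OF B(2)] by simp
qed

lemma column_submatrix_eq_select_columns:
  assumes A: "A \<in> carrier_mat d n" and I: "I \<subseteq> {..<n}" "card I = d"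
  shows "column_submatrix A I = select_columns A (pick I)"
proof -
  have "{j. j < dim_col A \<and> j \<in> I} = I" using A I by auto
  then show ?thesis using A I
    by (intro eq_matI) (auto simp: column_submatrix_def submatrix_def select_columns_def pick_UNIV)
qed

lemma bij_betw_pick:
  assumes "finite I"
  shows "bij_betw (pick I) {..<card I} I"
proof -
  have inj: "inj_on (pick I) {..<card I}"
    by (rule linorder_inj_onI) (use pick_mono_le[of _ I] in \<open>auto simp: nat_neq_iff\<close>)
  have "pick I ` {..<card I} \<subseteq> I" using pick_in_set_le by auto
  then have "pick I ` {..<card I} = I"
    using assms inj by (intro card_subset_eq) (auto simp: card_image)
  then show ?thesis using inj by (simp add: bij_betw_def)
qed

text \<open>The submatrix lists its columns in increasing order through \<open>pick\<close>; any
  other enumeration changes the determinant only in sign.\<close>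

lemma multiplicity_eq_abs_det:
  assumes A: "A \<in> carrier_mat d n" and f: "inj_on f {..<d}" "\<And>j. j < d \<Longrightarrow> f j < n"
    and indep: "columns_indep A (f ` {..<d})"
  shows "int (mult_fun (arith_matroid_of A) (f ` {..<d})) = \<bar>det (select_columns A f)\<bar>"
proof -
  let ?I = "f ` {..<d}"
  have I: "?I \<subseteq> {..<n}" "card ?I = d" using f by (auto simp: card_image)
  have pick: "bij_betw (pick ?I) {..<d} ?I" using bij_betw_pick[of ?I] I by simp
  have eq: "\<bar>det (select_columns A (pick ?I))\<bar> = \<bar>det (select_columns A f)\<bar>"
    using pick by (intro abs_det_select_columns_image_eq[OF A _ f(1)]) (auto simp: bij_betw_def)
  have "det (select_columns A f) \<noteq> 0" using columns_indep_iff_det[OF A f] indep by simp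
  then have "det (column_submatrix A ?I) \<noteq> 0"
    unfolding column_submatrix_eq_select_columns[OF A I] using eq by auto
  then have "int (invariant_factor_product (column_submatrix A ?I)) = \<bar>det (column_submatrix A ?I)\<bar>"
    by (intro invariant_factor_product_nonsingular[of _ d])
      (use A column_submatrix_eq_select_columns[OF A I] in auto)
  moreover have "mult_fun (arith_matroid_of A) ?I = invariant_factor_product (column_submatrix A ?I)"
    using I(1) A by (simp add: arith_matroid_of_def)
  ultimately show ?thesis using eq column_submatrix_eq_select_columns[OF A I] by simp
qed

text \<open>Repeated or dependent columns give zero on both sides, and dependence is read off the
  matroid. On independent selections the multiplicity is the absolute minor.\<close>

lemma abs_minors_eq_if_arith_matroid_eq:
  assumes A: "A \<in> carrier_mat d n" and A': "A' \<in> carrier_mat d n"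
    and M: "arith_matroid_of A = arith_matroid_of A'"
    and f: "\<And>j. j < d \<Longrightarrow> f j < n"
  shows "\<bar>det (select_columns A f)\<bar> = \<bar>det (select_columns A' f)\<bar>"
proof (cases "inj_on f {..<d}")
  case False
  then show ?thesis using A A' by (simp add: det_select_columns_not_inj)
next
  case True
  have I: "f ` {..<d} \<subseteq> {..<n}" using f by auto
  have "f ` {..<d} \<in> indep (arith_matroid_of A) \<longleftrightarrow> f ` {..<d} \<in> indep (arith_matroid_of A')"
    using M by simp
  then have iff: "columns_indep A (f ` {..<d}) \<longleftrightarrow> columns_indep A' (f ` {..<d})"
    using A A' I by (simp add: arith_matroid_of_def)
  show ?thesis
  proof (cases "columns_indep A (f ` {..<d})")
    case True
    then show ?thesis
      using multiplicity_eq_abs_det[OF A \<open>inj_on f {..<d}\<close> f]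
        multiplicity_eq_abs_det[OF A' \<open>inj_on f {..<d}\<close> f] iff M by simp
  next
    case False
    then show ?thesis
      using columns_indep_iff_det[OF A \<open>inj_on f {..<d}\<close> f]
        columns_indep_iff_det[OF A' \<open>inj_on f {..<d}\<close> f] iff by simp
  qed
qed

section \<open>Normalisation at the unimodular basis and conclusion\<close>

lemma select_columns_mult:
  assumes "P \<in> carrier_mat d d" "A \<in> carrier_mat d n" "\<And>j. j < d \<Longrightarrow> f j < n"
  shows "select_columns (P * A) f = P * select_columns A f"
  using assms by (intro eq_matI) (auto simp: select_columns_def scalar_prod_def)

text \<open>The submatrix \<open>N\<close> at the basis has an integral inverse \<open>P\<close>, so
  \<open>P * A\<close> is an integer matrix with the identity at the basis columns.\<close>

lemma normalise_unimodular_columns: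
  fixes A :: "int mat"
  assumes A: "A \<in> carrier_mat d n" and b: "\<And>j. j < d \<Longrightarrow> b j < n"
    and det: "\<bar>det (select_columns A b)\<bar> = 1"
  obtains P N C where "P \<in> carrier_mat d d" "N \<in> carrier_mat d d" "C \<in> carrier_mat d n"
    "\<bar>det P\<bar> = 1" "\<bar>det N\<bar> = 1" "C = P * A" "A = N * C"
    "\<And>i j. i < d \<Longrightarrow> j < d \<Longrightarrow> C $$ (i, b j) = (if i = j then 1 else 0)"
proof -
  define N where "N = select_columns A b"
  have N: "N \<in> carrier_mat d d" using A by (simp add: N_def)
  have sq: "det N * det N = 1" using det unfolding N_def by (metis abs_mult_self_eq mult_1)
  note adj = adj_mat[OF N]
  define P where "P = det N \<cdot>\<^sub>m adj_mat N"
  have P: "P \<in> carrier_mat d d" using adj(1) by (simp add: P_def)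
  have NP: "N * P = 1\<^sub>m d" and PN: "P * N = 1\<^sub>m d"
    using N adj sq by (auto simp: P_def mult_smult_distrib[of _ d d _ d] mult_smult_assoc_mat[of _ d d _ d]
        intro!: eq_matI)
  have "det P * det N = 1" using det_mult[OF P N] PN by simp
  then have detP: "\<bar>det P\<bar> = 1" using abs_zmult_eq_1[of "det P" "det N"] by simp
  have C: "P * A \<in> carrier_mat d n" using P A by simp
  have unit: "(P * A) $$ (i, b j) = (if i = j then 1 else 0)" if "i < d" "j < d" for i j
  proof -
    have "(P * A) $$ (i, b j) = select_columns (P * A) b $$ (i, j)" using C that by simp
    also have "\<dots> = (P * N) $$ (i, j)" using select_columns_mult[OF P A b] by (simp add: N_def)
    finally show ?thesis using PN that by simp
  qed
  have "N * (P * A) = (N * P) * A" using N P A by (simp add: assoc_mult_mat[of _ d d _ d _ n])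
  then have "A = N * (P * A)" using NP A by simp
  then show thesis using that[OF P N C detP] det unit by (simp add: N_def)
qed

theorem theorem7p2p1:
  fixes d n :: nat and A A' :: "int mat" and M :: arith_matroid
  assumes "represents d n A M"
    and "represents d n A' M"
    and "\<exists>B. is_basis M B \<and> mult_fun M B = 1"
  shows "\<exists>U \<in> carrier_mat d d. \<exists>D \<in> carrier_mat n n.
           invertible_mat U \<and> diagonal_mat D \<and> (\<forall>i < n. D $$ (i, i) \<in> {1, - 1}) \<and>
           A' = U * A * D"
proof -
  have A: "A \<in> carrier_mat d n" and A': "A' \<in> carrier_mat d n"
    and rank: "vec_space.rank d (map_mat rat_of_int A) = d"
    and M: "M = arith_matroid_of A" "arith_matroid_of A = arith_matroid_of A'"
    using assms(1,2) by (auto simp: represents_def)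
  obtain B where B: "is_basis (arith_matroid_of A) B" "mult_fun (arith_matroid_of A) B = 1"
    using assms(3) M(1) by blast
  have card: "card B = d" by (rule is_basis_card[OF A rank B(1)])
  have Bn: "B \<subseteq> {..<n}" and ind: "columns_indep A B"
    using B(1) A by (auto simp: is_basis_def arith_matroid_of_def)
  define b where "b = pick B"
  have bij: "bij_betw b {..<d} B"
    using bij_betw_pick[of B] finite_subset[OF Bn] card by (simp add: b_def)
  then have inj: "inj_on b {..<d}" and im: "b ` {..<d} = B" by (auto simp: bij_betw_def)
  have b: "b j < n" if "j < d" for j using that im Bn by auto
  note minors = abs_minors_eq_if_arith_matroid_eq[OF A A' M(2)]
  have det: "\<bar>det (select_columns A b)\<bar> = 1"
    using multiplicity_eq_abs_det[OF A inj b] ind im B(2) by simp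
  then have det': "\<bar>det (select_columns A' b)\<bar> = 1" using minors[of b] b by simp
  obtain P N C where C: "P \<in> carrier_mat d d" "N \<in> carrier_mat d d" "C \<in> carrier_mat d n"
    "\<bar>det P\<bar> = 1" "\<bar>det N\<bar> = 1" "C = P * A" "A = N * C"
    "\<And>i j. i < d \<Longrightarrow> j < d \<Longrightarrow> C $$ (i, b j) = (if i = j then 1 else 0)"
    by (rule normalise_unimodular_columns[OF A b det]) blast+
  obtain P' N' C' where C': "P' \<in> carrier_mat d d" "N' \<in> carrier_mat d d" "C' \<in> carrier_mat d n"
    "\<bar>det P'\<bar> = 1" "\<bar>det N'\<bar> = 1" "C' = P' * A'" "A' = N' * C'"
    "\<And>i j. i < d \<Longrightarrow> j < d \<Longrightarrow> C' $$ (i, b j) = (if i = j then 1 else 0)"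
    by (rule normalise_unimodular_columns[OF A' b det']) blast+
  \<comment> \<open>Left multiplication by a unimodular matrix changes every maximal minor only by a
    sign.\<close>
  have minors': "\<bar>det (select_columns C f)\<bar> = \<bar>det (select_columns C' f)\<bar>"
    if f: "\<And>j. j < d \<Longrightarrow> f j < n" for f
  proof -
    have "\<bar>det (select_columns A f)\<bar> = \<bar>det (select_columns A' f)\<bar>" by (rule minors) (rule f)
    moreover have "\<bar>det (select_columns C f)\<bar> = \<bar>det (select_columns A f)\<bar>"
      unfolding C(6) using select_columns_mult[OF C(1) A f] det_mult[OF C(1) select_columns_carrier[OF A]] C(4)
      by (simp only: abs_mult mult_1)
    moreover have "\<bar>det (select_columns C' f)\<bar> = \<bar>det (select_columns A' f)\<bar>"
      unfolding C'(6) using select_columns_mult[OF C'(1) A' f] det_mult[OF C'(1) select_columns_carrier[OF A']] C'(4)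
      by (simp only: abs_mult mult_1)
    ultimately show ?thesis by simp
  qed
  obtain s t :: "nat \<Rightarrow> int" where st: "\<And>i. \<bar>s i\<bar> = 1" "\<And>j. \<bar>t j\<bar> = 1"
    "\<And>i j. i < d \<Longrightarrow> j < n \<Longrightarrow> C' $$ (i, j) = s i * C $$ (i, j) * t j"
    using signs_from_abs_minors[OF C(3) C'(3) b C(8) C'(8) minors'] by blast
  define S where "S = mat d d (\<lambda>(i, j). if i = j then s i else 0)"
  define D where "D = mat n n (\<lambda>(i, j). if i = j then t i else 0)"
  have S: "S \<in> carrier_mat d d" and D: "D \<in> carrier_mat n n" by (simp_all add: S_def D_def)
  have detS: "\<bar>det S\<bar> = 1"
  proof -
    have "det S = prod_list (diag_mat S)"
      by (rule det_upper_triangular[OF _ S]) (auto simp: S_def)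
    also have "\<dots> = (\<Prod>i<d. s i)"
      using S by (simp add: prod_list_diag_prod atLeast0LessThan S_def)
    finally show ?thesis by (simp add: abs_prod st)
  qed
  have SC: "S * C \<in> carrier_mat d n" using S C(3) by simp
  have "C' = S * C * D"
  proof (intro eq_matI)
    fix i j assume "i < dim_row (S * C * D)" "j < dim_col (S * C * D)"
    then have ij: "i < d" "j < n" using S D by auto
    have "(S * C) $$ (i, j) = (\<Sum>k<d. S $$ (i, k) * C $$ (k, j))"
      by (rule index_mult_mat_sum[OF S C(3) ij])
    also have "\<dots> = (\<Sum>k<d. if k = i then s i * C $$ (k, j) else 0)"
      by (rule sum.cong) (use ij in \<open>auto simp: S_def\<close>)
    finally have 1: "(S * C) $$ (i, j) = s i * C $$ (i, j)" using ij by simp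
    have "(S * C * D) $$ (i, j) = (\<Sum>k<n. (S * C) $$ (i, k) * D $$ (k, j))"
      by (rule index_mult_mat_sum[OF SC D ij])
    also have "\<dots> = (\<Sum>k<n. if k = j then (S * C) $$ (i, k) * t j else 0)"
      by (rule sum.cong) (use ij in \<open>auto simp: D_def\<close>)
    finally show "C' $$ (i, j) = (S * C * D) $$ (i, j)" using ij 1 st(3) by simp
  qed (use S C'(3) D in auto)
  \<comment> \<open>Read off from \<open>A' = N' * C'\<close>, \<open>C' = S * C * D\<close> and
    \<open>C = P * A\<close>.\<close>
  define U where "U = N' * S * P"
  have U: "U \<in> carrier_mat d d" using C'(2) S C(1) by (simp add: U_def)
  have "A' = N' * (S * (P * A) * D)"
    using C'(7) unfolding \<open>C' = S * C * D\<close> C(6) .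
  also have "\<dots> = N' * (S * (P * A)) * D"
    using C'(2) S C(1) A D by (intro assoc_mult_mat[symmetric]) auto
  also have "N' * (S * (P * A)) = U * A"
    using C'(2) S C(1) A by (simp add: U_def assoc_mult_mat[of _ d d _ d _ n] assoc_mult_mat[of _ d d _ d _ d])
  finally have A'eq: "A' = U * A * D" .
  have "\<bar>det U\<bar> = 1"
    using C'(2,5) S detS C(1,4) by (simp add: U_def det_mult[of _ d] abs_mult)
  then have "invertible_mat U" by (rule invertible_mat_if_abs_det[OF U])
  moreover have "diagonal_mat D" by (auto simp: diagonal_mat_def D_def)
  moreover have "\<forall>i<n. D $$ (i, i) \<in> {1, - 1}"
  proof (intro allI impI)
    fix i assume "i < n"
    then show "D $$ (i, i) \<in> {1, - 1}" using st(2)[of i] by (auto simp: D_def abs_if split: if_splits)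
  qed
  ultimately show ?thesis using U D A'eq by blast
qed

end
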